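(* Let $s\ge 3$ be an integer, let $K_s\subset S^3$ be the $(-2,3,2s+1)$-pretzel knot, and let $\frac{p}{q}$ be a rational number with $\frac{p}{q}\ge 2s+3$. Then the fundamental group of the closed $3$-manifold obtained by Dehn surgery along $K_s$ with slope $\frac{p}{q}$ is not left-orderable.
   Context: A nontrivial group $G$ is left-orderable if it admits a total ordering $<$ that is invariant under left multiplication, i.e. $g<h$ implies $fg<fh$ for all $f,g,h\in G$. By convention, the trivial group is not left-orderable. Slopes $\frac{p}{q}$ are written in lowest terms, with respect to the standard meridian $M$ and (homologically trivial) longitude $L$ of the knot in $S^3$; surgery with slope $\frac pq$ kills $M^pL^q$. Chirality convention: the chirality of the $(-2,3,2s+1)$-pretzel knot $K_s$ is the one for which positive surgeries yield L-spaces. It is the one for which the knot group $\pi_1(S^3\setminus K_s)$ has the presentation (quoted from the literature) $$\langle c,l\mid c\,l\,c\,l^{-1}c^{-1}l^{-s}c^{-1}l^{-1}\,c\,l\,c\,l^{s-1}\rangle$$ with meridian $M=c$ and longitude $L=c^{-(2s-2)}\,l\,c\,l^{s}\,c\,l^{s}\,c\,l\,c^{-(2s+9)}$. Thus for coprime positive integers $p,q$ the fundamental group of the surgered manifold is $$\langle c,l\mid c\,l\,c\,l^{-1}c^{-1}l^{-s}c^{-1}l^{-1}\,c\,l\,c\,l^{s-1},\ M^pL^q\rangle .$$ *)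

theory Defs
  imports "HOL-Analysis.Analysis" "HOL-Homology.Homology"
begin

section \<open>Left-orderable groups\<close>

text \<open>The relation \<open>r\<close> is the strict order. The trivial group is not left-orderable.\<close>

definition left_orderable :: "('a, 'b) monoid_scheme \<Rightarrow> bool" where
  "left_orderable G \<longleftrightarrow>
     carrier G \<noteq> {\<one>\<^bsub>G\<^esub>} \<and>
     (\<exists>r. irrefl_on (carrier G) r \<and> trans_on (carrier G) r \<and> total_on (carrier G) r \<and>
          (\<forall>f\<in>carrier G. \<forall>g\<in>carrier G. \<forall>h\<in>carrier G.
             (g, h) \<in> r \<longrightarrow> (f \<otimes>\<^bsub>G\<^esub> g, f \<otimes>\<^bsub>G\<^esub> h) \<in> r))"

section \<open>Group presentations\<close>

text \<open>A word is a list of letters; \<open>(x, True)\<close> stands for the generator \<open>x\<close> and \<open>(x, False)\<close>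
  for its inverse. The generators are all elements of the type \<open>'g\<close>.\<close>

type_synonym 'g word = "('g \<times> bool) list"

inductive word_eq :: "'g word set \<Rightarrow> 'g word \<Rightarrow> 'g word \<Rightarrow> bool" for R where
  refl: "word_eq R u u"
| sym: "word_eq R u v \<Longrightarrow> word_eq R v u"
| trans: "word_eq R u v \<Longrightarrow> word_eq R v w \<Longrightarrow> word_eq R u w"
| append: "word_eq R u u' \<Longrightarrow> word_eq R v v' \<Longrightarrow> word_eq R (u @ v) (u' @ v')"
| cancel: "word_eq R [(x, b), (x, \<not> b)] []"
| relator: "r \<in> R \<Longrightarrow> word_eq R r []"

definition word_class :: "'g word set \<Rightarrow> 'g word \<Rightarrow> 'g word set" where
  "word_class R u = {v. word_eq R u v}"

definition presented_group :: "'g word set \<Rightarrow> 'g word set monoid" where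
  "presented_group R =
     \<lparr>carrier = range (word_class R),
      monoid.mult = (\<lambda>A B. {w. \<exists>u\<in>A. \<exists>v\<in>B. word_eq R (u @ v) w}),
      one = word_class R []\<rparr>"

text \<open>The word \<open>x\<^sub>1\<^bsup>k\<^sub>1\<^esup> x\<^sub>2\<^bsup>k\<^sub>2\<^esup> \<dots>\<close> for a list of pairs \<open>(x\<^sub>i, k\<^sub>i)\<close>.\<close>

definition power_word :: "('g \<times> int) list \<Rightarrow> 'g word" where
  "power_word xs = concat (map (\<lambda>(x, k). replicate (nat \<bar>k\<bar>) (x, 0 \<le> k)) xs)"

section \<open>Fundamental groups\<close>

definition loop_class :: "'a::topological_space set \<Rightarrow> (real \<Rightarrow> 'a) \<Rightarrow> (real \<Rightarrow> 'a) set" where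
  "loop_class S g = {h. homotopic_paths S g h}"

definition fundamental_group :: "'a::topological_space set \<Rightarrow> 'a \<Rightarrow> (real \<Rightarrow> 'a) set monoid" where
  "fundamental_group S x =
     \<lparr>carrier = loop_class S ` {g. path g \<and> path_image g \<subseteq> S \<and> pathstart g = x \<and> pathfinish g = x},
      monoid.mult = (\<lambda>A B. {h. \<exists>f\<in>A. \<exists>g\<in>B. homotopic_paths S (f +++ g) h}),
      one = loop_class S (\<lambda>_. x)\<rparr>"

text \<open>The homology class in \<open>H\<^sub>1(S; \<int>)\<close> of a closed path vanishes. A path is regarded as a singular
  1-simplex through the barycentric coordinate \<open>v 1\<close>.\<close>

definition null_homologous :: "'a::topological_space set \<Rightarrow> (real \<Rightarrow> 'a) \<Rightarrow> bool" where
  "null_homologous S g \<longleftrightarrow>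
     singular_relboundary 1 (top_of_set S) {}
       (frag_of (restrict (\<lambda>v. g (v 1)) (standard_simplex 1)))"

section \<open>Knots\<close>

text \<open>The three-sphere is the unit sphere of \<open>\<real>\<^sup>3 \<times> \<real>\<close>. Knots are placed in \<open>\<real>\<^sup>3\<close>, which inverse
  stereographic projection identifies with the sphere minus the point \<open>(0, 1)\<close>; the sphere carries
  the orientation for which this identification preserves orientation.\<close>

abbreviation S3 :: "((real^3) \<times> real) set" where
  "S3 \<equiv> sphere 0 1"

definition stereo :: "real^3 \<Rightarrow> (real^3) \<times> real" where
  "stereo x = ((2 / ((norm x)\<^sup>2 + 1)) *\<^sub>R x, ((norm x)\<^sup>2 - 1) / ((norm x)\<^sup>2 + 1))"

definition ambient_isotopic :: "(real^3) set \<Rightarrow> (real^3) set \<Rightarrow> bool" where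
  "ambient_isotopic K K' \<longleftrightarrow>
     (\<exists>H :: real \<Rightarrow> real^3 \<Rightarrow> real^3.
        continuous_on ({0..1} \<times> UNIV) (\<lambda>(t, x). H t x) \<and>
        (\<forall>t\<in>{0..1}. \<exists>g. homeomorphism UNIV UNIV (H t) g) \<and>
        H 0 = id \<and> H 1 ` K = K')"

text \<open>A column of \<open>a\<close> half twists: two strands winding around the vertical axis through
  \<open>(x, 0, 0)\<close> at heights \<open>0\<close> to \<open>1\<close>, right-handed for \<open>a > 0\<close> and left-handed for \<open>a < 0\<close>.\<close>

definition twist_column :: "int \<Rightarrow> real \<Rightarrow> (real^3) set" where
  "twist_column a x =
     {vector [x + e * cos (pi * of_int a * t), e * sin (pi * of_int a * t), t] | e t.
        e \<in> {-1, 1} \<and> t \<in> {0..1}}"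

text \<open>The pretzel link \<open>P(a, b, c)\<close>: neighbouring columns are joined at top and bottom, and the
  outermost strands are joined by arcs above and below the diagram.\<close>

definition pretzel_link :: "int \<Rightarrow> int \<Rightarrow> int \<Rightarrow> (real^3) set" where
  "pretzel_link a b c =
     twist_column a 0 \<union> twist_column b 4 \<union> twist_column c 8 \<union>
     (\<Union>z\<in>{0, 1}. closed_segment (vector [1, 0, z]) (vector [3, 0, z]) \<union>
                  closed_segment (vector [5, 0, z]) (vector [7, 0, z])) \<union>
     (\<Union>(z, z')\<in>{(0, -1), (1, 2)}.
        closed_segment (vector [-1, 0, z]) (vector [-1, 0, z']) \<union>
        closed_segment (vector [-1, 0, z']) (vector [9, 0, z']) \<union>
        closed_segment (vector [9, 0, z']) (vector [9, 0, z]))"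

text \<open>A tubular neighbourhood of \<open>K\<close>, parametrized by \<open>(z, t)\<close> with \<open>z\<close> in the closed unit disc
  and \<open>t \<in> \<real>/\<int>\<close>. It is a \<open>C\<^sup>1\<close> embedding that preserves orientation, so that the meridian has
  linking number \<open>+1\<close> with the knot directed by increasing \<open>t\<close>.\<close>

definition tubular_neighbourhood :: "(real^3) set \<Rightarrow> (complex \<Rightarrow> real \<Rightarrow> real^3) \<Rightarrow> bool" where
  "tubular_neighbourhood K \<tau> \<longleftrightarrow>
     range (\<tau> 0) = K \<and>
     (\<forall>z\<in>cball 0 1. \<forall>t. \<tau> z (t + 1) = \<tau> z t) \<and>
     inj_on (\<lambda>(z, t). \<tau> z t) (cball 0 1 \<times> {0..<1}) \<and>
     (\<exists>U (D :: complex \<times> real \<Rightarrow> (complex \<times> real) \<Rightarrow>\<^sub>L (real^3)).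
        open U \<and> cball 0 1 \<times> UNIV \<subseteq> U \<and> continuous_on U D \<and>
        (\<forall>y\<in>U. ((\<lambda>(z, t). \<tau> z t) has_derivative blinfun_apply (D y)) (at y)) \<and>
        (\<forall>y\<in>U. cross3 (D y (1, 0)) (D y (\<i>, 0)) \<bullet> D y (0, 1) > 0))"

definition knot_complement :: "(real^3) set \<Rightarrow> ((real^3) \<times> real) set" where
  "knot_complement K = S3 - stereo ` K"

definition torus_point :: "(complex \<Rightarrow> real \<Rightarrow> real^3) \<Rightarrow> (real^3) \<times> real" where
  "torus_point \<tau> = stereo (\<tau> 1 0)"

text \<open>The closed curve on the boundary torus that runs \<open>p\<close> times along the meridian and \<open>q\<close> times
  along the longitude.\<close>

definition torus_curve ::
    "(complex \<Rightarrow> real \<Rightarrow> real^3) \<Rightarrow> int \<Rightarrow> int \<Rightarrow> real \<Rightarrow> (real^3) \<times> real" where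
  "torus_curve \<tau> p q t = stereo (\<tau> (cis (2 * pi * of_int p * t)) (of_int q * t))"

abbreviation "meridian \<tau> \<equiv> torus_curve \<tau> 1 0"

abbreviation "longitude \<tau> \<equiv> torus_curve \<tau> 0 1"

text \<open>The framing is the standard one: the longitude is homologically trivial.\<close>

definition framed_neighbourhood :: "(real^3) set \<Rightarrow> (complex \<Rightarrow> real \<Rightarrow> real^3) \<Rightarrow> bool" where
  "framed_neighbourhood K \<tau> \<longleftrightarrow>
     tubular_neighbourhood K \<tau> \<and> null_homologous (knot_complement K) (longitude \<tau>)"

section \<open>Dehn surgery\<close>

text \<open>The exterior \<open>X\<close> of the knot and a solid torus are embedded in \<open>Y\<close> so that they cover \<open>Y\<close> and
  meet exactly in their boundary tori, and the boundary of a meridian disc of the solid torus is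
  the curve \<open>M\<^sup>p L\<^sup>q\<close>. The pieces are compact and \<open>Y\<close> is Hausdorff, so \<open>Y\<close> carries the quotient
  topology of the gluing and is determined up to homeomorphism.\<close>

definition dehn_surgery ::
    "(complex \<Rightarrow> real \<Rightarrow> real^3) \<Rightarrow> int \<Rightarrow> int \<Rightarrow> 'b::t2_space set \<Rightarrow> bool" where
  "dehn_surgery \<tau> p q Y \<longleftrightarrow>
     (let X = S3 - stereo ` (\<lambda>(z, t). \<tau> z t) ` (ball 0 1 \<times> UNIV);
          T = stereo ` (\<lambda>(z, t). \<tau> z t) ` (sphere 0 1 \<times> UNIV)
      in \<exists>(f :: (real^3) \<times> real \<Rightarrow> 'b) (g :: complex \<times> complex \<Rightarrow> 'b).
           continuous_on X f \<and> inj_on f X \<and>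
           continuous_on (cball 0 1 \<times> sphere 0 1) g \<and> inj_on g (cball 0 1 \<times> sphere 0 1) \<and>
           Y = f ` X \<union> g ` (cball 0 1 \<times> sphere 0 1) \<and>
           f ` X \<inter> g ` (cball 0 1 \<times> sphere 0 1) = f ` T \<and>
           f ` T = g ` (sphere 0 1 \<times> sphere 0 1) \<and>
           g ` (sphere 0 1 \<times> {1}) = f ` torus_curve \<tau> p q ` {0..1})"

section \<open>The \<open>(-2,3,2s+1)\<close>-pretzel knots\<close>

datatype gen = gen_c | gen_l

definition knot_relator :: "int \<Rightarrow> gen word" where
  "knot_relator s = power_word
     [(gen_c, 1), (gen_l, 1), (gen_c, 1), (gen_l, -1), (gen_c, -1), (gen_l, -s), (gen_c, -1), (gen_l, -1),
      (gen_c, 1), (gen_l, 1), (gen_c, 1), (gen_l, s - 1)]"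

definition meridian_word :: "gen word" where
  "meridian_word = power_word [(gen_c, 1)]"

definition longitude_word :: "int \<Rightarrow> gen word" where
  "longitude_word s = power_word
     [(gen_c, -(2 * s - 2)), (gen_l, 1), (gen_c, 1), (gen_l, s), (gen_c, 1), (gen_l, s), (gen_c, 1), (gen_l, 1),
      (gen_c, -(2 * s + 9))]"

text \<open>The chirality convention. A knot type and its mirror image have isomorphic knot groups, but
  reflection inverts exactly one of the meridian and the longitude. The chirality for which
  positive surgeries give L-spaces is the one for which the knot group has the presentation
  below with the stated meridian and longitude.\<close>

definition chirality_convention ::
    "int \<Rightarrow> (real^3) set \<Rightarrow> (complex \<Rightarrow> real \<Rightarrow> real^3) \<Rightarrow> bool" where
  "chirality_convention s K \<tau> \<longleftrightarrow>
     (\<exists>\<phi> \<in> iso (presented_group {knot_relator s})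
              (fundamental_group (knot_complement K) (torus_point \<tau>)).
        \<phi> (word_class {knot_relator s} meridian_word) =
          loop_class (knot_complement K) (meridian \<tau>) \<and>
        \<phi> (word_class {knot_relator s} (longitude_word s)) =
          loop_class (knot_complement K) (longitude \<tau>))"

text \<open>\<open>P(2, -3, -(2s+1))\<close> is the mirror image of \<open>P(-2, 3, 2s+1)\<close>.\<close>

definition pretzel_knot_Ks ::
    "int \<Rightarrow> (real^3) set \<Rightarrow> (complex \<Rightarrow> real \<Rightarrow> real^3) \<Rightarrow> bool" where
  "pretzel_knot_Ks s K \<tau> \<longleftrightarrow>
     (ambient_isotopic (pretzel_link (-2) 3 (2 * s + 1)) K \<or>
      ambient_isotopic (pretzel_link 2 (-3) (-(2 * s + 1))) K) \<and>
     framed_neighbourhood K \<tau> \<and>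
     chirality_convention s K \<tau>"

end

theory Submission
  imports Defs
begin

text \<open>Let \<open>G\<close> be the fundamental group of the surgered manifold, with \<open>c\<close>, \<open>l\<close> and \<open>L\<close> denoting the images in \<open>G\<close>
of the two generators and of the longitude. Topology contributes four facts: \<open>c\<close> and \<open>l\<close> generate
\<open>G\<close>, the relator of the knot group holds, \<open>c\<close> and \<open>L\<close> commute, and \<open>c\<^sup>p L\<^sup>q = 1\<close>
(\<open>surgery_not_left_orderable\<close>). The knot complement retracts radially onto the knot exterior, which
sits in the surgered manifold with an open solid torus as complement. A path in an open solid torus
can be pushed off the core circle, which has codimension two, and then radially out to the boundary;
hence every loop comes from the exterior (\<open>push_into_P\<close>), and \<open>c\<close> and \<open>l\<close> generate. The torus
curves form an image of \<open>\<int> \<times> \<int>\<close> (\<open>torus_curve_join\<close>), and the curve of slope \<open>p/q\<close> bounds a meridian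
disc of the new solid torus (\<open>slope_null_homotopic\<close>).

The rest is algebra. As \<open>p\<close> and \<open>q\<close> are coprime, there is \<open>k\<close> with \<open>c = k\<^sup>q\<close> and \<open>L = k\<^bsup>-p\<^esup>\<close>
(\<open>common_root\<close>). Put \<open>m = s - 1\<close>. The relator says

  \<open>l c l\<^sup>s c l = c l c l\<^sup>m c l c\<close>,

and therefore \<open>l c l\<^sup>s c l\<^sup>s c l = c A\<close> for \<open>A = l c l\<^sup>m c l c l\<^sup>m c l\<close>. The formula for the longitude
turns this into \<open>A = c\<^bsup>4s+6\<^esup> L = k\<^sup>N\<close> with \<open>N = (4s+6)q - p\<close>, and \<open>p/q \<ge> 2s+3\<close> says that
\<open>N \<le> (2s+3)q\<close>.

Suppose that \<open>G\<close> carries a left order. Write \<open>g \<lless> h\<close> if \<open>g x < h x\<close> for all \<open>x\<close>; this is a strict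
partial order invariant under multiplication on both sides. If neither \<open>1 \<lless> k\<close> nor \<open>k \<lless> 1\<close>, some
orbit of \<open>k\<close> is bounded and its limit is a cut of the order that \<open>k\<close> fixes (\<open>invariant_cut\<close>). Then \<open>c\<close>
and \<open>A\<close> fix it too. If \<open>l\<close> moved it in one direction, the word \<open>A\<close>, which is positive in \<open>c\<close> and \<open>l\<close>,
would move it in the same direction; so \<open>l\<close> fixes it, and \<open>G\<close> fixes a cut, although \<open>G\<close> acts on itself
transitively.

There remains \<open>1 \<lless> k\<close>, the case \<open>k \<lless> 1\<close> being the same for the reversed order. Now \<open>1 \<lless> c\<close>, and \<open>A\<close> is
at most \<open>c\<^bsup>2s+3\<^esup>\<close>. Dropping one factor \<open>c\<close> from the relation and cancelling gives \<open>c l c \<lless> l c l\<close>, and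
dropping two gives \<open>1 \<lless> l\<close>. Repeated use of the first inequality bounds \<open>A\<close> below by
\<open>c\<^sup>m (l c\<^sup>2 l c\<^sup>2 l) c\<^sup>m\<close>, and omitting two letters \<open>l\<close> shows \<open>c\<^bsup>m+4\<^esup> l c\<^sup>m \<lless> A\<close>, where the right hand
side is at most \<open>c\<^bsup>m+4\<^esup> c c\<^sup>m\<close>. Hence \<open>l \<lless> c\<close>. But then \<open>c l c \<lless> l c l\<close> lies below both \<open>l c c\<close> and
\<open>c c l\<close>, so that \<open>c l \<lless> l c\<close> and \<open>l c \<lless> c l\<close>, a contradiction (\<open>pretzel_relation_contradiction\<close>).\<close>

(* So that <# denotes left cosets only. *)
no_notation subset_mset (infix "<#" 50)

section \<open>Bi-invariant orders\<close>

locale bi_ordered_group = group G for G (structure) +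
  fixes lt :: "'a \<Rightarrow> 'a \<Rightarrow> bool" (infix "\<lless>" 50)
  assumes irrefl: "x \<in> carrier G \<Longrightarrow> \<not> x \<lless> x"
    and trans: "x \<lless> y \<Longrightarrow> y \<lless> z \<Longrightarrow> x \<in> carrier G \<Longrightarrow> y \<in> carrier G \<Longrightarrow> z \<in> carrier G \<Longrightarrow> x \<lless> z"
    and mult_left: "x \<lless> y \<Longrightarrow> g \<in> carrier G \<Longrightarrow> x \<in> carrier G \<Longrightarrow> y \<in> carrier G \<Longrightarrow> g \<otimes> x \<lless> g \<otimes> y"
    and mult_right: "x \<lless> y \<Longrightarrow> g \<in> carrier G \<Longrightarrow> x \<in> carrier G \<Longrightarrow> y \<in> carrier G \<Longrightarrow> x \<otimes> g \<lless> y \<otimes> g"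
begin

abbreviation le (infix "\<lless>\<^sub>=" 50) where "x \<lless>\<^sub>= y \<equiv> x = y \<or> x \<lless> y"

lemma le_trans: "x \<lless>\<^sub>= y \<Longrightarrow> y \<lless>\<^sub>= z \<Longrightarrow> x \<in> carrier G \<Longrightarrow> y \<in> carrier G \<Longrightarrow> z \<in> carrier G \<Longrightarrow> x \<lless>\<^sub>= z"
  using trans by blast

lemma le_mult:
  assumes "x \<lless>\<^sub>= y" "a \<in> carrier G" "b \<in> carrier G" "x \<in> carrier G" "y \<in> carrier G"
  shows "a \<otimes> x \<otimes> b \<lless>\<^sub>= a \<otimes> y \<otimes> b"
  using assms mult_left mult_right by (metis m_closed)

lemma cancel_left:
  assumes "g \<otimes> x \<lless> g \<otimes> y" "g \<in> carrier G" "x \<in> carrier G" "y \<in> carrier G"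
  shows "x \<lless> y"
proof -
  have "inv g \<otimes> (g \<otimes> x) \<lless> inv g \<otimes> (g \<otimes> y)"
    by (rule mult_left) (use assms in auto)
  then show ?thesis using assms by (metis l_inv l_one m_assoc inv_closed)
qed

lemma cancel_right:
  assumes "x \<otimes> g \<lless> y \<otimes> g" "g \<in> carrier G" "x \<in> carrier G" "y \<in> carrier G"
  shows "x \<lless> y"
proof -
  have "(x \<otimes> g) \<otimes> inv g \<lless> (y \<otimes> g) \<otimes> inv g"
    by (rule mult_right) (use assms in auto)
  then show ?thesis using assms by (metis r_inv r_one m_assoc inv_closed)
qed

lemma less_mult_left:
  assumes "\<one> \<lless> g" "g \<in> carrier G" "x \<in> carrier G"
  shows "x \<lless> g \<otimes> x"
  using mult_right[of "\<one>" g x] assms by simp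

lemma less_mult_right:
  assumes "\<one> \<lless> g" "g \<in> carrier G" "x \<in> carrier G"
  shows "x \<lless> x \<otimes> g"
  using mult_left[of "\<one>" g x] assms by simp

lemma insert_less:
  assumes "\<one> \<lless> g" "g \<in> carrier G" "x \<in> carrier G" "y \<in> carrier G"
  shows "x \<otimes> y \<lless> x \<otimes> g \<otimes> y"
  using less_mult_right[of g x] assms by (intro mult_right) auto

lemma one_less_pow:
  assumes "\<one> \<lless> g" "g \<in> carrier G"
  shows "\<one> \<lless> g [^] Suc n"
proof (induction n)
  case (Suc n)
  then show ?case
    using assms less_mult_right[of g "g [^] Suc n"] trans[of "\<one>" "g [^] Suc n" "g [^] Suc (Suc n)"]
    by simp
qed (use assms in simp)

lemma int_pow_mono:
  fixes i j :: int
  assumes "\<one> \<lless> g" "g \<in> carrier G" "i \<le> j"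
  shows "g [^] i \<lless>\<^sub>= g [^] j"
proof (cases "i = j")
  case False
  then obtain n where n: "j = i + int (Suc n)"
    using assms(3) by (metis zle_iff_zadd not0_implies_Suc add.right_neutral of_nat_0)
  have "g [^] j = g [^] i \<otimes> g [^] Suc n"
    using assms(2) unfolding n by (simp only: int_pow_mult int_pow_int)
  then show ?thesis
    using less_mult_right[of "g [^] Suc n" "g [^] i"] one_less_pow[OF assms(1,2), of n] assms(2) by simp
qed auto

text \<open>With \<open>u = l c l\<^sup>m\<close> the relation reads \<open>u l c l = c u c l c\<close>. It compares words of different
composition, so leaving out positive factors on the right yields inequalities between short words.
The word \<open>A\<close> has \<open>2m + 7\<close> letters and is bounded by only \<open>2m + 5\<close> letters \<open>c\<close>; this slack pays
for the two letters \<open>l\<close> that are left out when \<open>A\<close> is estimated from below.\<close>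

theorem pretzel_relation_contradiction:
  fixes m :: nat
  assumes cl: "c \<in> carrier G" "l \<in> carrier G" and c: "\<one> \<lless> c"
    and R: "l \<otimes> c \<otimes> l [^] Suc m \<otimes> c \<otimes> l = c \<otimes> l \<otimes> c \<otimes> l [^] m \<otimes> c \<otimes> l \<otimes> c"
    and A: "l \<otimes> c \<otimes> l [^] m \<otimes> c \<otimes> l \<otimes> c \<otimes> l [^] m \<otimes> c \<otimes> l \<lless>\<^sub>= c [^] (2 * m + 5)"
  shows False
proof -
  note [simp] = cl m_assoc
  have commute: "x \<otimes> x [^] a = x [^] a \<otimes> x" if "x \<in> carrier G" for x and a :: nat
    using that nat_pow_Suc2[of x a] by simp
  then have commute': "x \<otimes> (x [^] a \<otimes> y) = x [^] a \<otimes> (x \<otimes> y)"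
    if "x \<in> carrier G" "y \<in> carrier G" for x y and a :: nat
    using that by (metis m_assoc nat_pow_closed)
  have R': "l \<otimes> (c \<otimes> (l [^] m \<otimes> (l \<otimes> (c \<otimes> l)))) = c \<otimes> (l \<otimes> (c \<otimes> (l [^] m \<otimes> (c \<otimes> (l \<otimes> c)))))"
    using R by simp
  let ?u = "l \<otimes> (c \<otimes> l [^] m)"
  \<comment> \<open>Leave out the first \<open>c\<close> of \<open>c u c l c\<close>.\<close>
  have braid: "c \<otimes> l \<otimes> c \<lless> l \<otimes> c \<otimes> l"
  proof -
    have "?u \<otimes> (c \<otimes> l \<otimes> c) \<lless> c \<otimes> (?u \<otimes> (c \<otimes> l \<otimes> c))"
      by (rule less_mult_left) (auto simp: c)
    also have "\<dots> = ?u \<otimes> (l \<otimes> c \<otimes> l)" using R' by simp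
    finally show ?thesis by (rule cancel_left) auto
  qed
  \<comment> \<open>Leave out the first and the last \<open>c\<close> of \<open>c u c l c\<close>.\<close>
  have l: "\<one> \<lless> l"
  proof -
    have "?u \<otimes> (c \<otimes> l) \<lless> c \<otimes> (?u \<otimes> (c \<otimes> l))"
      by (rule less_mult_left) (auto simp: c)
    moreover have "c \<otimes> (?u \<otimes> (c \<otimes> l)) \<lless> c \<otimes> (?u \<otimes> (c \<otimes> l)) \<otimes> c"
      by (rule less_mult_right) (auto simp: c)
    ultimately have "?u \<otimes> (c \<otimes> l) \<lless> c \<otimes> (?u \<otimes> (c \<otimes> l)) \<otimes> c"
      by (rule trans) auto
    also have "\<dots> = ?u \<otimes> (l \<otimes> (c \<otimes> l))" using R' by simp
    finally have "c \<otimes> l \<lless> l \<otimes> (c \<otimes> l)" by (rule cancel_left) auto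
    then have "\<one> \<otimes> (c \<otimes> l) \<lless> l \<otimes> (c \<otimes> l)" by simp
    then show ?thesis by (rule cancel_right) auto
  qed
  \<comment> \<open>By \<open>c l c \<lless> l c l\<close>, one more \<open>l\<close> on the right is worth one more \<open>c\<close> on the left.\<close>
  have left: "c [^] n \<otimes> l \<otimes> c \<lless>\<^sub>= l \<otimes> c \<otimes> l [^] n" for n :: nat
  proof (induction n)
    case (Suc n)
    have "c [^] n \<otimes> (c \<otimes> l \<otimes> c) \<otimes> \<one> \<lless>\<^sub>= c [^] n \<otimes> (l \<otimes> c \<otimes> l) \<otimes> \<one>"
      by (rule le_mult) (use braid in auto)
    moreover have "\<one> \<otimes> (c [^] n \<otimes> l \<otimes> c) \<otimes> l \<lless>\<^sub>= \<one> \<otimes> (l \<otimes> c \<otimes> l [^] n) \<otimes> l"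
      by (rule le_mult) (use Suc in auto)
    ultimately show ?case
      using le_trans[of "c [^] n \<otimes> (c \<otimes> l \<otimes> c)" "c [^] n \<otimes> (l \<otimes> c \<otimes> l)" "l \<otimes> c \<otimes> l [^] n \<otimes> l"] by simp
  qed auto
  have right: "c \<otimes> l \<otimes> c [^] n \<lless>\<^sub>= l [^] n \<otimes> c \<otimes> l" for n :: nat
  proof (induction n)
    case (Suc n)
    have "\<one> \<otimes> (c \<otimes> l \<otimes> c) \<otimes> c [^] n \<lless>\<^sub>= \<one> \<otimes> (l \<otimes> c \<otimes> l) \<otimes> c [^] n"
      by (rule le_mult) (use braid in auto)
    moreover have "l \<otimes> (c \<otimes> l \<otimes> c [^] n) \<otimes> \<one> \<lless>\<^sub>= l \<otimes> (l [^] n \<otimes> c \<otimes> l) \<otimes> \<one>"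
      by (rule le_mult) (use Suc in auto)
    ultimately show ?case
      using le_trans[of "c \<otimes> l \<otimes> c \<otimes> c [^] n" "l \<otimes> c \<otimes> l \<otimes> c [^] n" "l \<otimes> (l [^] n \<otimes> c \<otimes> l)"]
      by (simp add: commute commute')
  qed auto
  have less: "l \<lless> c"
  proof -
    let ?A = "l \<otimes> c \<otimes> l [^] m \<otimes> c \<otimes> l \<otimes> c \<otimes> l [^] m \<otimes> c \<otimes> l"
    let ?B = "c [^] m \<otimes> l \<otimes> c \<otimes> c \<otimes> l \<otimes> c \<otimes> (c \<otimes> l \<otimes> c [^] m)"
    let ?C = "c [^] m \<otimes> (c \<otimes> c) \<otimes> (l \<otimes> (c \<otimes> (c \<otimes> (l \<otimes> c [^] m))))"
    have "c [^] (m + 4) \<otimes> c \<otimes> c [^] m = c [^] (Suc (m + 4) + m)"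
      using cl(1) by (metis nat_pow_Suc nat_pow_mult)
    also have "Suc (m + 4) + m = 2 * m + 5" by simp
    finally have A': "?A \<lless>\<^sub>= c [^] (m + 4) \<otimes> c \<otimes> c [^] m"
      using A by simp
    have "\<one> \<otimes> (c [^] m \<otimes> l \<otimes> c) \<otimes> (c \<otimes> l \<otimes> c \<otimes> (c \<otimes> l \<otimes> c [^] m))
          \<lless>\<^sub>= \<one> \<otimes> (l \<otimes> c \<otimes> l [^] m) \<otimes> (c \<otimes> l \<otimes> c \<otimes> (c \<otimes> l \<otimes> c [^] m))"
      by (rule le_mult) (use left in auto)
    moreover have "(l \<otimes> c \<otimes> l [^] m \<otimes> c \<otimes> l \<otimes> c) \<otimes> (c \<otimes> l \<otimes> c [^] m) \<otimes> \<one>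
          \<lless>\<^sub>= (l \<otimes> c \<otimes> l [^] m \<otimes> c \<otimes> l \<otimes> c) \<otimes> (l [^] m \<otimes> c \<otimes> l) \<otimes> \<one>"
      by (rule le_mult) (use right in auto)
    ultimately have BA: "?B \<lless>\<^sub>= ?A"
      using le_trans[of ?B "l \<otimes> c \<otimes> l [^] m \<otimes> c \<otimes> l \<otimes> c \<otimes> (c \<otimes> l \<otimes> c [^] m)" ?A] by simp
    \<comment> \<open>\<open>?C\<close> and the next word arise from \<open>?B\<close> by omitting the first and the second \<open>l\<close>.\<close>
    have "c [^] m \<otimes> (c \<otimes> c \<otimes> (l \<otimes> (c \<otimes> (c \<otimes> (l \<otimes> c [^] m)))))
          \<lless> c [^] m \<otimes> l \<otimes> (c \<otimes> c \<otimes> (l \<otimes> (c \<otimes> (c \<otimes> (l \<otimes> c [^] m)))))"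
      by (rule insert_less) (auto simp: l)
    then have CB: "?C \<lless> ?B" by simp
    have "c [^] m \<otimes> (c \<otimes> c) \<otimes> (c \<otimes> (c \<otimes> (l \<otimes> c [^] m))) \<lless> c [^] m \<otimes> (c \<otimes> c) \<otimes> l \<otimes> (c \<otimes> (c \<otimes> (l \<otimes> c [^] m)))"
      by (rule insert_less) (auto simp: l)
    then have DC: "c [^] m \<otimes> (c \<otimes> c) \<otimes> (c \<otimes> (c \<otimes> (l \<otimes> c [^] m))) \<lless> ?C" by simp
    have "c [^] (m + 4) = c [^] m \<otimes> (c \<otimes> c) \<otimes> (c \<otimes> c)"
      by (simp add: numeral_eq_Suc)
    then have "c [^] (m + 4) \<otimes> l \<otimes> c [^] m \<lless> ?C" using DC by simp
    then have "c [^] (m + 4) \<otimes> l \<otimes> c [^] m \<lless> ?A"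
      using CB BA trans[of "c [^] (m + 4) \<otimes> l \<otimes> c [^] m" ?C ?B] trans[of "c [^] (m + 4) \<otimes> l \<otimes> c [^] m" ?B ?A]
      by (auto simp del: m_assoc)
    then have "c [^] (m + 4) \<otimes> l \<otimes> c [^] m \<lless> c [^] (m + 4) \<otimes> c \<otimes> c [^] m"
      using A' trans[of "c [^] (m + 4) \<otimes> l \<otimes> c [^] m" ?A "c [^] (m + 4) \<otimes> c \<otimes> c [^] m"]
      by (auto simp del: m_assoc)
    then have "c [^] (m + 4) \<otimes> l \<lless> c [^] (m + 4) \<otimes> c"
      by (rule cancel_right) auto
    then show ?thesis by (rule cancel_left) auto
  qed
  \<comment> \<open>Replace the last, and then the first, \<open>l\<close> of \<open>l c l\<close> by the larger \<open>c\<close>.\<close>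
  have "c \<otimes> l \<lless> l \<otimes> c"
  proof -
    have "(l \<otimes> c) \<otimes> l \<lless> (l \<otimes> c) \<otimes> c" by (rule mult_left) (auto simp: less)
    with braid have "(c \<otimes> l) \<otimes> c \<lless> (l \<otimes> c) \<otimes> c"
      using trans[of "c \<otimes> l \<otimes> c" "l \<otimes> c \<otimes> l" "l \<otimes> c \<otimes> c"] by auto
    then show ?thesis by (rule cancel_right) auto
  qed
  moreover have "l \<otimes> c \<lless> c \<otimes> l"
  proof -
    have "l \<otimes> (c \<otimes> l) \<lless> c \<otimes> (c \<otimes> l)" by (rule mult_right) (auto simp: less)
    with braid have "c \<otimes> (l \<otimes> c) \<lless> c \<otimes> (c \<otimes> l)"
      using trans[of "c \<otimes> l \<otimes> c" "l \<otimes> c \<otimes> l" "c \<otimes> c \<otimes> l"] by auto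
    then show ?thesis by (rule cancel_left) auto
  qed
  ultimately have "c \<otimes> l \<lless> c \<otimes> l" by (rule trans) auto
  then show False using irrefl by auto
qed

end

section \<open>Left orders\<close>

locale left_ordered_group = group G for G (structure) +
  fixes less :: "'a \<Rightarrow> 'a \<Rightarrow> bool" (infix "\<lessdot>" 50)
  assumes irrefl: "x \<in> carrier G \<Longrightarrow> \<not> x \<lessdot> x"
    and trans: "x \<lessdot> y \<Longrightarrow> y \<lessdot> z \<Longrightarrow> x \<in> carrier G \<Longrightarrow> y \<in> carrier G \<Longrightarrow> z \<in> carrier G \<Longrightarrow> x \<lessdot> z"
    and total: "x \<in> carrier G \<Longrightarrow> y \<in> carrier G \<Longrightarrow> x \<lessdot> y \<or> x = y \<or> y \<lessdot> x"
    and mult_left: "x \<lessdot> y \<Longrightarrow> g \<in> carrier G \<Longrightarrow> x \<in> carrier G \<Longrightarrow> y \<in> carrier G \<Longrightarrow> g \<otimes> x \<lessdot> g \<otimes> y"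
    and nontrivial: "carrier G \<noteq> {\<one>}"
begin

text \<open>The pointwise order of the action of \<open>G\<close> on itself by left translation. Right invariance, which the
left order lacks, comes from the quantifier over all points.\<close>

definition everywhere_less :: "'a \<Rightarrow> 'a \<Rightarrow> bool" where
  "everywhere_less g h \<longleftrightarrow> (\<forall>x\<in>carrier G. g \<otimes> x \<lessdot> h \<otimes> x)"

lemma bi_ordered_everywhere_less: "bi_ordered_group G everywhere_less"
proof unfold_locales
  fix x y g
  assume "everywhere_less x y" "g \<in> carrier G" "x \<in> carrier G" "y \<in> carrier G"
  then show "everywhere_less (x \<otimes> g) (y \<otimes> g)" "everywhere_less (g \<otimes> x) (g \<otimes> y)"
    unfolding everywhere_less_def by (auto simp: m_assoc mult_left)
qed (use irrefl trans in \<open>unfold everywhere_less_def, (blast | metis m_closed one_closed)+\<close>)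

lemma bi_ordered_everywhere_greater: "bi_ordered_group G (\<lambda>g h. everywhere_less h g)"
proof -
  interpret bi: bi_ordered_group G everywhere_less by (rule bi_ordered_everywhere_less)
  show ?thesis
  proof unfold_locales
    fix x y z
    assume "everywhere_less y x" "everywhere_less z y" "x \<in> carrier G" "y \<in> carrier G" "z \<in> carrier G"
    then show "everywhere_less z x" using bi.trans[of z y x] by simp
  qed (rule bi.irrefl bi.mult_left bi.mult_right; assumption)+
qed

text \<open>Cuts play the role of points in the completion of the order: \<open>G\<close> acts on them by translation, and
a bounded monotone orbit has a cut as its limit.\<close>

definition cut :: "'a set \<Rightarrow> bool" where
  "cut D \<longleftrightarrow> D \<subseteq> carrier G \<and> D \<noteq> {} \<and> D \<noteq> carrier G \<and> (\<forall>x\<in>D. \<forall>y\<in>carrier G. y \<lessdot> x \<longrightarrow> y \<in> D)"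

lemma cut_comparable:
  assumes "cut D" "cut E"
  shows "D \<subseteq> E \<or> E \<subseteq> D"
  using assms total unfolding cut_def by (metis subset_iff)

lemma cut_translate:
  assumes "cut D" "g \<in> carrier G"
  shows "cut (g <# D)"
proof -
  have sub: "D \<subseteq> carrier G" using assms(1) by (simp add: cut_def)
  have "g <# D \<noteq> carrier G"
  proof
    assume "g <# D = carrier G"
    then have "inv g <# (g <# D) = inv g <# carrier G" by simp
    also have "inv g <# (g <# D) = D" using sub assms(2) by (simp add: lcos_m_assoc lcos_mult_one)
    also have "inv g <# carrier G = carrier G"
    proof (intro equalityI subsetI)
      fix x assume "x \<in> carrier G"
      then have "g \<otimes> x \<in> carrier G" "x = inv g \<otimes> (g \<otimes> x)"
        using assms(2) by (simp_all add: m_assoc[symmetric])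
      then show "x \<in> inv g <# carrier G" unfolding l_coset_def by blast
    qed (use assms(2) in \<open>auto simp: l_coset_def\<close>)
    finally show False using assms(1) by (simp add: cut_def)
  qed
  moreover have "y \<in> g <# D" if x: "x \<in> g <# D" and "y \<in> carrier G" "y \<lessdot> x" for x y
  proof -
    obtain d where d: "d \<in> D" "x = g \<otimes> d" using x unfolding l_coset_def by blast
    have "inv g \<otimes> y \<lessdot> inv g \<otimes> x" using that d sub assms(2) by (intro mult_left) auto
    also have "inv g \<otimes> x = d" using d sub assms(2) by (auto simp: m_assoc[symmetric])
    finally have "inv g \<otimes> y \<in> D" using assms that d sub by (auto simp: cut_def)
    moreover have "y = g \<otimes> (inv g \<otimes> y)" using assms(2) that by (simp add: m_assoc[symmetric])
    ultimately show ?thesis unfolding l_coset_def by blast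
  qed
  moreover have "g <# D \<subseteq> carrier G" "g <# D \<noteq> {}"
    using sub assms by (auto simp: l_coset_def cut_def)
  ultimately show ?thesis
    unfolding cut_def by blast
qed

text \<open>A nontrivial left-ordered group has a positive element \<open>g\<close>, and \<open>x \<lessdot> x g\<close>. This makes the downward
closure of a bounded orbit a proper subset.\<close>

lemma no_maximum:
  assumes "x \<in> carrier G"
  obtains y where "y \<in> carrier G" "x \<lessdot> y"
proof -
  obtain g where g: "g \<in> carrier G" "g \<noteq> \<one>" using nontrivial one_closed by blast
  then consider "\<one> \<lessdot> g" | "g \<lessdot> \<one>" using total by blast
  then show ?thesis
  proof cases
    case 1
    then show ?thesis using that[of "x \<otimes> g"] mult_left[of \<one> g x] g assms by simp
  next
    case 2
    then have "inv g \<otimes> g \<lessdot> inv g \<otimes> \<one>" using g by (intro mult_left) auto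
    then show ?thesis using that[of "x \<otimes> inv g"] mult_left[of \<one> "inv g" x] g assms by simp
  qed
qed

text \<open>The assumptions say \<open>y \<le> k y\<close>, \<open>k x \<le> x\<close> and \<open>y \<le> x\<close>, so the orbit of \<open>y\<close> increases but stays below
\<open>x\<close>. Its downward closure is the invariant cut.\<close>

lemma invariant_cut_if_bounded_orbit:
  assumes "k \<in> carrier G" "x \<in> carrier G" "y \<in> carrier G"
    and "\<not> k \<otimes> y \<lessdot> y" "\<not> x \<lessdot> k \<otimes> x" "\<not> x \<lessdot> y"
  obtains D where "cut D" "k <# D = D"
proof
  let ?le = "\<lambda>x y. \<not> y \<lessdot> x"
  let ?D = "{z \<in> carrier G. \<exists>n::nat. ?le z (k [^] n \<otimes> y)}"
  have le_trans: "?le a d" if "?le a b" "?le b d" "a \<in> carrier G" "b \<in> carrier G" "d \<in> carrier G" for a b d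
    using total[of a b] trans[of d a b] that by blast
  have le_mult: "?le (g \<otimes> a) (g \<otimes> b)" if "?le a b" "a \<in> carrier G" "b \<in> carrier G" "g \<in> carrier G" for a b g
  proof
    assume "g \<otimes> b \<lessdot> g \<otimes> a"
    then have "inv g \<otimes> (g \<otimes> b) \<lessdot> inv g \<otimes> (g \<otimes> a)" by (rule mult_left) (use that in auto)
    then show False using that by (simp add: m_assoc[symmetric])
  qed
  have bound: "?le (k [^] n \<otimes> y) x" for n :: nat
  proof (induction n)
    case (Suc n)
    then have "?le (k \<otimes> (k [^] n \<otimes> y)) (k \<otimes> x)" using assms by (intro le_mult) auto
    then have "?le (k \<otimes> (k [^] n \<otimes> y)) x"
      using le_trans[OF _ assms(5), of "k \<otimes> (k [^] n \<otimes> y)"] assms(1-3) by simp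
    then show ?case using assms(1,3) nat_pow_Suc2[of k n] by (simp add: m_assoc)
  qed (use assms in simp)
  show "cut ?D"
    unfolding cut_def
  proof (intro conjI ballI impI)
    show "?D \<noteq> {}" using assms(3) irrefl by (auto intro!: exI[of _ y] exI[of _ "0::nat"])
    obtain z where "z \<in> carrier G" "x \<lessdot> z" using no_maximum assms(2) .
    then have "k [^] n \<otimes> y \<lessdot> z" for n :: nat
      using le_trans[OF _ bound[of n], of z] assms(1-3) by auto
    then have "z \<notin> ?D" by blast
    then show "?D \<noteq> carrier G" using \<open>z \<in> carrier G\<close> by blast
    fix a b assume a: "a \<in> ?D" and b: "b \<in> carrier G" "b \<lessdot> a"
    then obtain n :: nat where "?le a (k [^] n \<otimes> y)" by blast
    moreover have "?le b a" using a b trans[of a b a] irrefl by auto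
    ultimately have "?le b (k [^] n \<otimes> y)" using le_trans[of a b "k [^] n \<otimes> y"] a b assms(1,3) by simp
    then show "b \<in> ?D" using b by blast
  qed auto
  show "k <# ?D = ?D"
  proof (intro equalityI subsetI)
    fix z assume "z \<in> k <# ?D"
    then obtain w and n :: nat where w: "w \<in> carrier G" "?le w (k [^] n \<otimes> y)" "z = k \<otimes> w"
      by (auto simp: l_coset_def)
    then have "?le (k \<otimes> w) (k \<otimes> (k [^] n \<otimes> y))" using assms by (intro le_mult) auto
    then have "?le z (k [^] Suc n \<otimes> y)" using w assms(1,3) nat_pow_Suc2[of k n] by (simp add: m_assoc)
    then show "z \<in> ?D" using w assms(1) by blast
  next
    fix z assume "z \<in> ?D"
    then obtain n :: nat where z: "z \<in> carrier G" "?le z (k [^] n \<otimes> y)" by blast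
    have "?le (k [^] n \<otimes> y) (k [^] n \<otimes> (k \<otimes> y))" using assms by (intro le_mult) auto
    then have "?le z (k [^] n \<otimes> (k \<otimes> y))" using le_trans[OF z(2)] z(1) assms(1-3) by simp
    moreover have "k [^] n \<otimes> (k \<otimes> y) = k \<otimes> (k [^] n \<otimes> y)"
      using assms(1,3) nat_pow_Suc2[of k n] by (simp add: m_assoc[symmetric])
    ultimately have "?le (inv k \<otimes> z) (inv k \<otimes> (k \<otimes> (k [^] n \<otimes> y)))" using assms z by (intro le_mult) auto
    then have "?le (inv k \<otimes> z) (k [^] n \<otimes> y)" using assms(1,3) by (simp add: m_assoc[symmetric])
    moreover have "z = k \<otimes> (inv k \<otimes> z)" using assms(1) z by (simp add: m_assoc[symmetric])
    ultimately show "z \<in> k <# ?D" using assms(1) z unfolding l_coset_def by blast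
  qed
qed

text \<open>Some point \<open>y\<close> is not moved down and some point \<open>x\<close> is not moved up. If \<open>y\<close> is the smaller one, its
forward orbit is trapped below \<open>x\<close>; otherwise the backward orbit of \<open>x\<close> is trapped below \<open>y\<close>.\<close>

lemma invariant_cut:
  assumes k: "k \<in> carrier G" and "\<not> everywhere_less \<one> k" "\<not> everywhere_less k \<one>"
  obtains D where "cut D" "k <# D = D"
proof -
  obtain x where x: "x \<in> carrier G" "\<not> x \<lessdot> k \<otimes> x" using assms by (auto simp: everywhere_less_def)
  obtain y where y: "y \<in> carrier G" "\<not> k \<otimes> y \<lessdot> y" using assms by (auto simp: everywhere_less_def)
  show ?thesis
  proof (cases "x \<lessdot> y")
    case False
    then show ?thesis using invariant_cut_if_bounded_orbit[of k x y] that k x y by blast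
  next
    case True
    have cancel: "a \<lessdot> b" if "inv k \<otimes> a \<lessdot> inv k \<otimes> b" "a \<in> carrier G" "b \<in> carrier G" for a b
      using mult_left[OF that(1), of k] that k by (simp add: m_assoc[symmetric])
    have inv_mult: "inv k \<otimes> (k \<otimes> a) = a" if "a \<in> carrier G" for a using that k by (simp add: m_assoc[symmetric])
    have "\<not> inv k \<otimes> x \<lessdot> x"
      using x k mult_left[of "inv k \<otimes> x" x k] by (auto simp: m_assoc[symmetric])
    moreover have "\<not> y \<lessdot> inv k \<otimes> y"
      using y k mult_left[of y "inv k \<otimes> y" k] by (auto simp: m_assoc[symmetric])
    moreover have "\<not> y \<lessdot> x" using True x y trans irrefl by blast
    ultimately obtain D where D: "cut D" "inv k <# D = D"
      using invariant_cut_if_bounded_orbit[of "inv k" y x] k x y by auto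
    then have "k <# D = (k \<otimes> inv k) <# D"
      using lcos_m_assoc[of D k "inv k"] k by (simp add: cut_def)
    also have "\<dots> = D" using D k by (simp add: cut_def lcos_mult_one)
    finally show ?thesis using that D by blast
  qed
qed

lemma translate_mono: "D \<subseteq> E \<Longrightarrow> g <# D \<subseteq> g <# E"
  by (auto simp: l_coset_def)

lemma inflating_mult:
  assumes "D \<subseteq> g <# D" "D \<subseteq> h <# D" "D \<subseteq> carrier G" "g \<in> carrier G" "h \<in> carrier G"
  shows "D \<subseteq> (g \<otimes> h) <# D"
  using assms translate_mono[OF assms(2), of g] lcos_m_assoc[of D g h] by auto

lemma inflating_pow:
  assumes "D \<subseteq> g <# D" "D \<subseteq> carrier G" "g \<in> carrier G"
  shows "D \<subseteq> (g [^] (n::nat)) <# D"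
  by (induction n) (use assms in \<open>simp_all add: lcos_mult_one inflating_mult\<close>)

text \<open>Every letter after the first only enlarges \<open>D\<close>, so the whole word maps \<open>D\<close> onto a set containing
\<open>l D\<close>; as the word fixes \<open>D\<close>, there is no room between \<open>D\<close> and \<open>l D\<close>.\<close>

lemma fixed_if_inflating:
  fixes m :: nat
  assumes c: "c \<in> carrier G" "D \<subseteq> c <# D" and l: "l \<in> carrier G" "D \<subseteq> l <# D" and D: "D \<subseteq> carrier G"
    and A: "(l \<otimes> (c \<otimes> l [^] m \<otimes> c \<otimes> l \<otimes> c \<otimes> l [^] m \<otimes> c \<otimes> l)) <# D = D"
  shows "l <# D = D"
proof -
  let ?B = "c \<otimes> l [^] m \<otimes> c \<otimes> l \<otimes> c \<otimes> l [^] m \<otimes> c \<otimes> l"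
  have "D \<subseteq> ?B <# D"
    using c l D inflating_pow[OF l(2) D l(1), of m]
    by (intro inflating_mult) auto
  then have "l <# D \<subseteq> (l \<otimes> ?B) <# D"
    using translate_mono[of D "?B <# D" l] lcos_m_assoc[of D l ?B] c l D by auto
  then show ?thesis using A l(2) by blast
qed

lemma translate_inv:
  assumes "g \<in> carrier G" "D \<subseteq> carrier G"
  shows "inv g <# (g <# D) = D"
  using assms by (simp add: lcos_m_assoc lcos_mult_one)

lemma subgroup_stabilizer:
  assumes "D \<subseteq> carrier G"
  shows "subgroup {g \<in> carrier G. g <# D = D} G"
proof (rule subgroupI)
  fix a b assume "a \<in> {g \<in> carrier G. g <# D = D}" "b \<in> {g \<in> carrier G. g <# D = D}"
  then show "a \<otimes> b \<in> {g \<in> carrier G. g <# D = D}"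
    using assms lcos_m_assoc[of D a b] by auto
next
  fix a assume "a \<in> {g \<in> carrier G. g <# D = D}"
  then show "inv a \<in> {g \<in> carrier G. g <# D = D}"
    using assms translate_inv[of a D] by auto
qed (use assms in \<open>auto simp: lcos_mult_one intro!: exI[of _ \<one>]\<close>)

text \<open>Left translation is transitive, so an invariant nonempty set is everything.\<close>

lemma cut_not_invariant:
  assumes "cut D"
  shows "\<exists>g\<in>carrier G. g <# D \<noteq> D"
proof (rule ccontr)
  assume inv: "\<not> ?thesis"
  obtain d where d: "d \<in> D" "d \<in> carrier G" using assms by (auto simp: cut_def)
  have "x \<in> D" if "x \<in> carrier G" for x
  proof -
    have "x \<otimes> inv d \<otimes> d \<in> (x \<otimes> inv d) <# D" using d unfolding l_coset_def by blast
    then show ?thesis using inv that d by (simp add: m_assoc)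
  qed
  then show False using assms by (auto simp: cut_def)
qed

text \<open>Either \<open>k\<close> is comparable to \<open>\<one>\<close> in the pointwise order, and the inequalities for bi-invariant orders
apply, or \<open>k\<close> fixes a cut, and this cut is then fixed by \<open>l\<close> and hence by the whole group.\<close>

theorem no_pretzel_relation:
  fixes q N :: int and m :: nat
  assumes kl: "k \<in> carrier G" "l \<in> carrier G" and q: "q > 0" and N: "N \<le> (2 * int m + 5) * q"
    and c: "c = k [^] q"
    and R: "l \<otimes> c \<otimes> l [^] Suc m \<otimes> c \<otimes> l = c \<otimes> l \<otimes> c \<otimes> l [^] m \<otimes> c \<otimes> l \<otimes> c"
    and A: "l \<otimes> c \<otimes> l [^] m \<otimes> c \<otimes> l \<otimes> c \<otimes> l [^] m \<otimes> c \<otimes> l = k [^] N"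
    and gen: "\<And>H. subgroup H G \<Longrightarrow> c \<in> H \<Longrightarrow> l \<in> H \<Longrightarrow> H = carrier G"
  shows False
proof -
  have cc: "c \<in> carrier G" using kl c by simp
  have ordered: False if "bi_ordered_group G lt" "lt \<one> k" for lt
  proof -
    interpret bi: bi_ordered_group G lt by fact
    define n where "n = nat (q - 1)"
    have n: "q = int (Suc n)" using q by (simp add: n_def)
    have "lt \<one> c" using bi.one_less_pow[OF that(2) kl(1), of n] by (simp only: c n int_pow_int)
    moreover have "k [^] ((2 * int m + 5) * q) = c [^] (2 * m + 5)"
    proof -
      have "c [^] (2 * m + 5) = c [^] int (2 * m + 5)" by (simp only: int_pow_int)
      also have "\<dots> = k [^] (q * int (2 * m + 5))" using kl by (simp only: c int_pow_pow)
      finally show ?thesis by (simp add: mult.commute)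
    qed
    ultimately show False
      using bi.pretzel_relation_contradiction[OF cc kl(2) _ R] bi.int_pow_mono[OF that(2) kl(1) N] A by auto
  qed
  show False
  proof (cases "everywhere_less \<one> k \<or> everywhere_less k \<one>")
    case True
    then show False
      using ordered[OF bi_ordered_everywhere_less] ordered[OF bi_ordered_everywhere_greater] by blast
  next
    case False
    then obtain D where D: "cut D" "k <# D = D" using invariant_cut[OF kl(1)] by blast
    then have sub: "D \<subseteq> carrier G" by (simp add: cut_def)
    let ?S = "{g \<in> carrier G. g <# D = D}"
    note stab = subgroup_stabilizer[OF sub]
    have pow: "k [^] i <# D = D" for i :: int
      using subgroup_int_pow_closed[OF stab, of k i] kl D by simp
    let ?A = "l \<otimes> (c \<otimes> l [^] m \<otimes> c \<otimes> l \<otimes> c \<otimes> l [^] m \<otimes> c \<otimes> l)"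
    have A': "?A = k [^] N" using A kl cc by (simp add: m_assoc)
    have "l <# D = D"
    proof (cases "D \<subseteq> l <# D")
      case True
      then show ?thesis
        using fixed_if_inflating[of c D l m] cc kl sub pow[of q] pow[of N] by (simp add: A' c[symmetric])
    next
      case False
      then have "l <# D \<subseteq> D" using cut_comparable cut_translate D kl by blast
      \<comment> \<open>The inverse of the word is the same word in the inverse letters, since the word is a palindrome.\<close>
      then have "D \<subseteq> inv l <# D" using translate_mono[of "l <# D" D "inv l"] translate_inv kl sub by simp
      moreover have "inv c <# D = D" using translate_inv[of c D] cc sub pow[of q] by (simp add: c)
      moreover have "inv l \<otimes> (inv c \<otimes> inv l [^] m \<otimes> inv c \<otimes> inv l \<otimes> inv c \<otimes> inv l [^] m \<otimes> inv c \<otimes> inv l) = inv ?A"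
        using cc kl by (simp add: inv_mult_group m_assoc nat_pow_inv)
      moreover have "inv ?A <# D = D" using translate_inv[of ?A D] A' kl sub pow[of N] by simp
      ultimately have "inv l <# D = D"
        using fixed_if_inflating[of "inv c" D "inv l" m] cc kl sub by simp
      then show ?thesis using translate_inv[of "inv l" D] kl sub by simp
    qed
    then have "?S = carrier G" using gen[OF stab] cc kl pow[of q] by (simp add: c)
    then show False using cut_not_invariant[OF D(1)] by blast
  qed
qed

end

section \<open>Slopes\<close>

context group
begin

lemma int_pow_commute:
  assumes xy: "x \<in> carrier G" "y \<in> carrier G" and comm: "x \<otimes> y = y \<otimes> x"
  shows "x [^] (i::int) \<otimes> y = y \<otimes> x [^] i"
proof -
  have nat: "x [^] n \<otimes> y = y \<otimes> x [^] n" for n :: nat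
  proof (induction n)
    case (Suc n)
    have "x [^] Suc n \<otimes> y = (x [^] n \<otimes> y) \<otimes> x" using xy comm by (simp add: m_assoc)
    then show ?case using xy by (simp add: Suc m_assoc)
  qed (use xy in simp)
  have neg: "inv g \<otimes> y = y \<otimes> inv g" if "g \<otimes> y = y \<otimes> g" "g \<in> carrier G" for g
  proof -
    have "inv g \<otimes> y = inv g \<otimes> (y \<otimes> g) \<otimes> inv g" using that(2) xy by (simp add: m_assoc)
    also have "\<dots> = y \<otimes> inv g" using that(2) xy by (simp add: that(1)[symmetric]) (simp add: m_assoc[symmetric])
    finally show ?thesis .
  qed
  show ?thesis
  proof (cases i rule: int_cases2)
    case (nonneg n)
    show ?thesis unfolding nonneg int_pow_int by (rule nat)
  next
    case (nonpos n)
    show ?thesis unfolding nonpos int_pow_neg_int[OF xy(1)] by (rule neg[OF nat]) (use xy in simp)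
  qed
qed

text \<open>If \<open>a p + b q = 1\<close>, then \<open>c\<^sup>b L\<^bsup>-a\<^esup>\<close> is the common root.\<close>

lemma common_root:
  fixes p q :: int
  assumes "coprime p q" "c \<in> carrier G" "L \<in> carrier G" "c \<otimes> L = L \<otimes> c"
    and pq: "c [^] p \<otimes> L [^] q = \<one>"
  obtains k where "k \<in> carrier G" "c = k [^] q" "L = k [^] (- p)"
proof -
  obtain a b where ab: "a * p + b * q = 1"
    using bezout_int[of p q] coprime_imp_gcd_eq_1[OF assms(1)] by metis
  let ?k = "c [^] b \<otimes> L [^] (- a)"
  have Lq: "L [^] q = c [^] (- p)"
    using inv_equality[OF pq] inv_inv[of "L [^] q"] assms(2,3) by (simp add: int_pow_neg)
  have comm: "c [^] b \<otimes> L [^] (- a) = L [^] (- a) \<otimes> c [^] b"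
    using assms(2,3) int_pow_commute[OF assms(2) _ int_pow_commute[OF assms(3,2) assms(4)[symmetric], symmetric]] by simp
  have "?k [^] q = c [^] (b * q) \<otimes> (L [^] q) [^] (- a)"
    using assms(2,3) int_pow_mult_distrib[OF comm] by (simp add: int_pow_pow mult.commute)
  also have "\<dots> = c [^] (b * q + a * p)"
    using assms(2) by (simp add: Lq int_pow_pow int_pow_mult mult.commute)
  finally have kq: "?k [^] q = c" using ab assms(2) by (simp add: add.commute)
  have "?k [^] (- p) = (c [^] (- p)) [^] b \<otimes> L [^] (a * p)"
    using assms(2,3) int_pow_mult_distrib[OF comm] by (simp add: int_pow_pow mult.commute)
  then have "?k [^] (- p) = L [^] (b * q + a * p)"
    using assms(3) by (simp add: Lq[symmetric] int_pow_pow int_pow_mult mult.commute)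
  then have kp: "?k [^] (- p) = L" using ab assms(3) by (simp add: add.commute)
  show ?thesis using that[OF _ kq[symmetric] kp[symmetric]] assms(2,3) by simp
qed

text \<open>The relator is brought into its symmetric form \<open>l c l\<^sup>s c l = c l c l\<^bsup>s-1\<^esup> c l c\<close>, and with this form the
longitude determines the palindrome \<open>A\<close> as a power of the common root of \<open>c\<close> and \<open>L\<close>.\<close>

theorem pretzel_surgery_quotient_not_left_orderable:
  fixes s p q :: int
  assumes cl: "c \<in> carrier G" "l \<in> carrier G"
    and gen: "\<And>H. subgroup H G \<Longrightarrow> c \<in> H \<Longrightarrow> l \<in> H \<Longrightarrow> H = carrier G"
    and s: "s \<ge> 1" and q: "q > 0" and pq: "coprime p q" "p \<ge> (2 * s + 3) * q"
    and rel: "c \<otimes> l \<otimes> c \<otimes> inv l \<otimes> inv c \<otimes> l [^] (- s) \<otimes> inv c \<otimes> inv l \<otimes> c \<otimes> l \<otimes> c \<otimes> l [^] (s - 1) = \<one>"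
    and L: "L = c [^] (- (2 * s - 2)) \<otimes> l \<otimes> c \<otimes> l [^] s \<otimes> c \<otimes> l [^] s \<otimes> c \<otimes> l \<otimes> c [^] (- (2 * s + 9))"
    and comm: "c \<otimes> L = L \<otimes> c"
    and slope: "c [^] p \<otimes> L [^] q = \<one>"
  shows "\<not> left_orderable G"
proof
  assume "left_orderable G"
  then obtain r where "carrier G \<noteq> {\<one>}" "irrefl_on (carrier G) r" "trans_on (carrier G) r" "total_on (carrier G) r"
    and left: "\<forall>f\<in>carrier G. \<forall>g\<in>carrier G. \<forall>h\<in>carrier G. (g, h) \<in> r \<longrightarrow> (f \<otimes> g, f \<otimes> h) \<in> r"
    unfolding left_orderable_def by blast
  then interpret left_ordered_group G "\<lambda>x y. (x, y) \<in> r"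
    by unfold_locales (auto simp: irrefl_on_def total_on_def dest: trans_onD)
  have Lc: "L \<in> carrier G" using cl by (simp add: L)
  obtain k where k: "k \<in> carrier G" "c = k [^] q" "L = k [^] (- p)"
    by (rule common_root[OF pq(1) cl(1) Lc comm slope])
  define m where "m = nat (s - 1)"
  have m: "s - 1 = int m" and sm: "s = int (Suc m)" using s by (simp_all add: m_def)
  have pow: "l [^] (s - 1) = l [^] m" "l [^] s = l [^] Suc m" "l [^] (- s) = inv (l [^] Suc m)"
    by (simp only: m int_pow_int, simp only: sm int_pow_int, simp only: sm int_pow_neg_int[OF cl(2)])
  let ?W' = "l \<otimes> c \<otimes> l [^] Suc m \<otimes> c \<otimes> l" and ?Q = "c \<otimes> l \<otimes> c \<otimes> l [^] m"
  have R: "?W' = ?Q \<otimes> c \<otimes> l \<otimes> c"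
  proof -
    have "(c \<otimes> l \<otimes> c \<otimes> inv ?W') \<otimes> ?Q = \<one>"
      using rel cl unfolding pow by (simp add: m_assoc inv_mult_group del: nat_pow_Suc)
    then have "?Q \<otimes> (c \<otimes> l \<otimes> c \<otimes> inv ?W') = \<one>"
      by (rule inv_comm) (use cl in auto)
    then have "(?Q \<otimes> c \<otimes> l \<otimes> c) \<otimes> inv ?W' = \<one>"
      using cl by (simp add: m_assoc del: nat_pow_Suc)
    then have "inv (inv ?W') = ?Q \<otimes> c \<otimes> l \<otimes> c"
      by (rule inv_equality) (use cl in auto)
    then show ?thesis using cl by simp
  qed
  let ?A = "l \<otimes> c \<otimes> l [^] m \<otimes> c \<otimes> l \<otimes> c \<otimes> l [^] m \<otimes> c \<otimes> l"
  let ?W = "l \<otimes> c \<otimes> l [^] Suc m \<otimes> c \<otimes> l [^] Suc m \<otimes> c \<otimes> l"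
  have "?W = ?W' \<otimes> (l [^] m \<otimes> c \<otimes> l)"
    using cl nat_pow_Suc2[of l m] by (simp add: m_assoc)
  also have "\<dots> = c \<otimes> ?A" unfolding R using cl by (simp add: m_assoc)
  finally have WA: "?W = c \<otimes> ?A" .
  have "L = c [^] (- (2 * s - 2)) \<otimes> ?W \<otimes> c [^] (- (2 * s + 9))"
    using cl unfolding L pow by (simp add: m_assoc del: nat_pow_Suc)
  then have "c [^] (2 * s - 2) \<otimes> L \<otimes> c [^] (2 * s + 9) = 
      (c [^] (2 * s - 2) \<otimes> c [^] (- (2 * s - 2))) \<otimes> ?W \<otimes> (c [^] (- (2 * s + 9)) \<otimes> c [^] (2 * s + 9))"
    using cl by (simp only: m_assoc m_closed int_pow_closed nat_pow_closed)
  also have "\<dots> = ?W" using cl by (simp add: int_pow_mult[symmetric] del: nat_pow_Suc)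
  also have "c [^] (2 * s - 2) \<otimes> L \<otimes> c [^] (2 * s + 9) = k [^] (q * (2 * s - 2) - p + q * (2 * s + 9))"
    using k(1) unfolding k(2,3) by (simp only: int_pow_pow int_pow_mult diff_conv_add_uminus)
  finally have "k [^] q \<otimes> ?A = k [^] (q * (2 * s - 2) - p + q * (2 * s + 9))"
    using WA k(2) by simp
  also have "q * (2 * s - 2) - p + q * (2 * s + 9) = q + ((4 * s + 6) * q - p)"
    by (simp add: algebra_simps)
  also have "k [^] \<dots> = k [^] q \<otimes> k [^] ((4 * s + 6) * q - p)"
    using k(1) by (rule int_pow_mult)
  finally have A: "?A = k [^] ((4 * s + 6) * q - p)"
    using cl k(1) by simp
  have "(4 * s + 6) * q - p \<le> (2 * int m + 5) * q"
    using pq(2) by (simp add: sm algebra_simps)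
  then show False
    using no_pretzel_relation[OF k(1) cl(2) q _ k(2) R A] gen by simp
qed

end

section \<open>Group presentations\<close>

lemma word_class_eq: "word_eq R u v \<Longrightarrow> word_class R u = word_class R v"
  unfolding word_class_def by (blast intro: word_eq.sym word_eq.trans)

lemma presented_mult: "word_class R u \<otimes>\<^bsub>presented_group R\<^esub> word_class R v = word_class R (u @ v)"
  unfolding presented_group_def word_class_def
  by (auto intro: word_eq.refl word_eq.sym word_eq.trans word_eq.append)

lemma carrier_presented: "carrier (presented_group R) = range (word_class R)"
  by (simp add: presented_group_def)

locale presented_group_hom = group G for G (structure) +
  fixes R :: "'g word set" and h
  assumes hom: "h \<in> hom (presented_group R) G"
begin

definition val :: "'g word \<Rightarrow> 'a" where "val w = h (word_class R w)"

definition gen_val :: "'g \<Rightarrow> 'a" where "gen_val x = val [(x, True)]"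

lemma val_closed [simp]: "val w \<in> carrier G"
  using hom by (auto simp: val_def hom_def carrier_presented)

lemma gen_val_closed [simp]: "gen_val x \<in> carrier G"
  by (simp add: gen_val_def)

lemma val_append: "val (u @ v) = val u \<otimes> val v"
  using hom by (simp add: val_def presented_mult[symmetric] hom_def carrier_presented)

lemma val_Nil [simp]: "val [] = \<one>"
  using val_append[of "[]" "[]"] by (simp add: l_cancel_one)

lemma val_relator: "r \<in> R \<Longrightarrow> val r = \<one>"
  using word_class_eq[OF word_eq.relator, of r R] val_Nil by (metis val_def)

lemma val_inverse: "val [(x, False)] = inv (gen_val x)"
proof -
  have "word_class R ([(x, False)] @ [(x, True)]) = word_class R []"
    using word_eq.cancel[of R x False] by (intro word_class_eq) simp
  then have "val [(x, False)] \<otimes> gen_val x = \<one>"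
    unfolding gen_val_def val_append[symmetric] by (simp only: val_def flip: val_Nil)
  then show ?thesis using inv_equality[of "val [(x, False)]" "gen_val x"] by simp
qed

lemma val_replicate: "val (replicate n y) = val [y] [^] n"
proof (induction n)
  case (Suc n)
  then show ?case
    using val_append[of "[y]" "replicate n y"] nat_pow_Suc2[of "val [y]" n] by simp
qed simp

lemma val_power_word_Cons:
  "val (power_word ((x, k) # xs)) = gen_val x [^] k \<otimes> val (power_word xs)"
proof -
  have "val (replicate (nat \<bar>k\<bar>) (x, 0 \<le> k)) = gen_val x [^] k"
  proof (cases "0 \<le> k")
    case True
    then show ?thesis using int_pow_int[of G "gen_val x" "nat k"] by (simp add: val_replicate gen_val_def)
  next
    case False
    then have "k = - int (nat \<bar>k\<bar>)" by simp
    then have "gen_val x [^] k = inv (gen_val x [^] nat \<bar>k\<bar>)"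
      by (metis int_pow_neg_int gen_val_closed)
    then show ?thesis using False by (simp add: val_replicate val_inverse nat_pow_inv int_pow_inv)
  qed
  then show ?thesis by (simp add: power_word_def val_append)
qed

lemma val_power_word_Nil [simp]: "val (power_word []) = \<one>"
  by (simp add: power_word_def)

lemma val_in_subgroup:
  assumes "subgroup H G" "\<And>x. gen_val x \<in> H"
  shows "val w \<in> H"
proof (induction w)
  case Nil
  then show ?case using assms(1) by (simp add: subgroup.one_closed)
next
  case (Cons a w)
  obtain x b where a: "a = (x, b)" by (cases a)
  have "val [a] \<in> H"
    using assms by (cases b) (auto simp: a val_inverse subgroup.m_inv_closed simp flip: gen_val_def)
  then show ?case using Cons val_append[of "[a]" w] assms(1) by (simp add: subgroup.m_closed)
qed

end

section \<open>Fundamental groups\<close>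

definition loops :: "'a::topological_space set \<Rightarrow> 'a \<Rightarrow> (real \<Rightarrow> 'a) set" where
  "loops S x = {g. path g \<and> path_image g \<subseteq> S \<and> pathstart g = x \<and> pathfinish g = x}"

lemma carrier_fundamental_group: "carrier (fundamental_group S x) = loop_class S ` loops S x"
  by (simp add: fundamental_group_def loops_def)

lemma loop_class_eq: "homotopic_paths S f g \<Longrightarrow> loop_class S f = loop_class S g"
  unfolding loop_class_def by (blast intro: homotopic_paths_sym homotopic_paths_trans)

lemma loops_join [simp]: "f \<in> loops S x \<Longrightarrow> g \<in> loops S x \<Longrightarrow> f +++ g \<in> loops S x"
  by (auto simp: loops_def path_image_join)

lemma loop_class_mem: "f \<in> loops S x \<Longrightarrow> f \<in> loop_class S f"
  by (simp add: loop_class_def loops_def)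

lemma fundamental_group_mult:
  assumes "f \<in> loops S x" "g \<in> loops S x"
  shows "loop_class S f \<otimes>\<^bsub>fundamental_group S y\<^esub> loop_class S g = loop_class S (f +++ g)"
proof -
  have "homotopic_paths S (f +++ g) (f' +++ g')"
    if "homotopic_paths S f f'" "homotopic_paths S g g'" for f' g'
    using that assms by (intro homotopic_paths_join) (auto simp: loops_def)
  then have "{h. \<exists>f'\<in>loop_class S f. \<exists>g'\<in>loop_class S g. homotopic_paths S (f' +++ g') h} = loop_class S (f +++ g)"
    using loop_class_mem[OF assms(1)] loop_class_mem[OF assms(2)] unfolding loop_class_def
    by (blast intro: homotopic_paths_trans)
  then show ?thesis by (simp add: fundamental_group_def)
qed

text \<open>Two paths in the interval with the same ends are homotopic, the interval being convex. The unit and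
inverse laws for paths in an arbitrary space follow, because both sides of each law factor as
\<open>p\<close> after a path in the interval.\<close>

lemma homotopic_paths_factor_interval:
  fixes a b :: "real \<Rightarrow> real"
  assumes "path p" "path_image p \<subseteq> S" "path a" "path b" "path_image a \<subseteq> {0..1}" "path_image b \<subseteq> {0..1}"
    and "pathstart b = pathstart a" "pathfinish b = pathfinish a"
  shows "homotopic_paths S (p \<circ> a) (p \<circ> b)"
proof (rule homotopic_paths_continuous_image)
  have "closed_segment (a t) (b t) \<subseteq> {0..1}" if "t \<in> {0..1}" for t
  proof -
    have "a t \<in> {0..1}" "b t \<in> {0..1}" using assms(5,6) that unfolding path_image_def by blast+
    then show ?thesis by (intro closed_segment_subset convex_real_interval)
  qed
  then show "homotopic_paths {0..1} a b"
    using assms by (intro homotopic_paths_linear) auto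
qed (use assms in \<open>auto simp: path_def path_image_def\<close>)

lemma compose_linepath_01: "path p \<Longrightarrow> p \<circ> linepath 0 1 = p"
  by (simp add: fun_eq_iff linepath_def)

lemma path_const [simp]: "path (\<lambda>_. x)"
  by (simp add: path_def)

lemma path_image_const [simp]: "path_image (\<lambda>_. x) = {x}"
  by (auto simp: path_image_def)

lemma pathstart_const [simp]: "pathstart (\<lambda>_. x) = x"
  and pathfinish_const [simp]: "pathfinish (\<lambda>_. x) = x"
  by (simp_all add: pathstart_def pathfinish_def)

lemma homotopic_paths_const_right:
  assumes "path p" "path_image p \<subseteq> S" "pathfinish p = x"
  shows "homotopic_paths S (p +++ (\<lambda>_. x)) p"
proof -
  have "homotopic_paths S (p \<circ> (linepath 0 1 +++ (\<lambda>_. 1))) (p \<circ> linepath 0 1)"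
    using assms by (intro homotopic_paths_factor_interval) (auto simp: path_image_join closed_segment_eq_real_ivl)
  then show ?thesis
    using assms by (simp add: path_compose_join compose_linepath_01) (simp add: comp_def pathfinish_def)
qed

lemma homotopic_paths_const_left:
  assumes "path p" "path_image p \<subseteq> S" "pathstart p = x"
  shows "homotopic_paths S ((\<lambda>_. x) +++ p) p"
proof -
  have "homotopic_paths S (p \<circ> ((\<lambda>_. 0) +++ linepath 0 1)) (p \<circ> linepath 0 1)"
    using assms by (intro homotopic_paths_factor_interval) (auto simp: path_image_join closed_segment_eq_real_ivl)
  then show ?thesis
    using assms by (simp add: path_compose_join compose_linepath_01) (simp add: comp_def pathstart_def)
qed

lemma homotopic_paths_join_reversepath:
  assumes "path p" "path_image p \<subseteq> S"
  shows "homotopic_paths S (p +++ reversepath p) (\<lambda>_. pathstart p)"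
proof -
  have "homotopic_paths S (p \<circ> (linepath 0 1 +++ reversepath (linepath 0 1))) (p \<circ> (\<lambda>_. 0))"
    using assms by (intro homotopic_paths_factor_interval) (auto simp: path_image_join closed_segment_eq_real_ivl)
  then show ?thesis
    using assms
    by (simp add: path_compose_join path_compose_reversepath compose_linepath_01 del: reversepath_linepath)
      (simp add: comp_def pathstart_def)
qed

lemma cancel_reversepath:
  assumes "path d" "path p" "path_image d \<subseteq> S" "path_image p \<subseteq> S" "pathstart p = pathstart d"
  shows "homotopic_paths S (d +++ (reversepath d +++ p)) p"
proof -
  have "homotopic_paths S (d +++ (reversepath d +++ p)) ((d +++ reversepath d) +++ p)"
    using assms by (intro homotopic_paths_assoc) auto
  also have "homotopic_paths S \<dots> ((\<lambda>_. pathstart d) +++ p)"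
    using assms homotopic_paths_join_reversepath[of d S] by (intro homotopic_paths_join) auto
  also have "homotopic_paths S \<dots> p"
    using assms by (intro homotopic_paths_const_left) auto
  finally show ?thesis .
qed

lemma cancel_reversepath':
  assumes "path d" "path p" "path_image d \<subseteq> S" "path_image p \<subseteq> S" "pathstart p = pathfinish d"
  shows "homotopic_paths S (reversepath d +++ (d +++ p)) p"
  using cancel_reversepath[of "reversepath d" p S] assms by simp

lemma group_fundamental_group:
  assumes "x \<in> S"
  shows "group (fundamental_group S x)"
proof (rule groupI)
  have const: "(\<lambda>_. x) \<in> loops S x" using assms by (auto simp: loops_def)
  have one: "\<one>\<^bsub>fundamental_group S x\<^esub> = loop_class S (\<lambda>_. x)" by (simp add: fundamental_group_def)
  show "\<one>\<^bsub>fundamental_group S x\<^esub> \<in> carrier (fundamental_group S x)"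
    unfolding one carrier_fundamental_group using const by blast
  fix A assume "A \<in> carrier (fundamental_group S x)"
  then obtain f where A: "A = loop_class S f" and f: "f \<in> loops S x"
    unfolding carrier_fundamental_group by blast
  show "\<one>\<^bsub>fundamental_group S x\<^esub> \<otimes>\<^bsub>fundamental_group S x\<^esub> A = A"
    unfolding one A fundamental_group_mult[OF const f]
    using f by (intro loop_class_eq homotopic_paths_const_left) (auto simp: loops_def)
  have rev: "reversepath f \<in> loops S x" using f by (auto simp: loops_def)
  have "loop_class S (reversepath f) \<otimes>\<^bsub>fundamental_group S x\<^esub> A = \<one>\<^bsub>fundamental_group S x\<^esub>"
    unfolding one A fundamental_group_mult[OF rev f]
    using homotopic_paths_join_reversepath[of "reversepath f" S] f by (intro loop_class_eq) (auto simp: loops_def)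
  then show "\<exists>B\<in>carrier (fundamental_group S x). B \<otimes>\<^bsub>fundamental_group S x\<^esub> A = \<one>\<^bsub>fundamental_group S x\<^esub>"
    using rev unfolding carrier_fundamental_group by blast
  fix B assume "B \<in> carrier (fundamental_group S x)"
  then obtain g where B: "B = loop_class S g" and g: "g \<in> loops S x"
    unfolding carrier_fundamental_group by blast
  have fg: "f +++ g \<in> loops S x" using f g by simp
  then show "A \<otimes>\<^bsub>fundamental_group S x\<^esub> B \<in> carrier (fundamental_group S x)"
    unfolding A B fundamental_group_mult[OF f g] carrier_fundamental_group by blast
  fix C assume "C \<in> carrier (fundamental_group S x)"
  then obtain h where C: "C = loop_class S h" and h: "h \<in> loops S x"
    unfolding carrier_fundamental_group by blast
  have gh: "g +++ h \<in> loops S x" using g h by simp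
  have "homotopic_paths S (f +++ (g +++ h)) ((f +++ g) +++ h)"
    using f g h by (intro homotopic_paths_assoc) (auto simp: loops_def)
  then show "A \<otimes>\<^bsub>fundamental_group S x\<^esub> B \<otimes>\<^bsub>fundamental_group S x\<^esub> C =
      A \<otimes>\<^bsub>fundamental_group S x\<^esub> (B \<otimes>\<^bsub>fundamental_group S x\<^esub> C)"
    unfolding A B C fundamental_group_mult[OF f g] fundamental_group_mult[OF fg h]
      fundamental_group_mult[OF g h] fundamental_group_mult[OF f gh]
    by (intro loop_class_eq) (rule homotopic_paths_sym)
qed

text \<open>\<open>\<Phi>\<close> acts on loops and not on points, so that composition with a continuous map followed by a change
of base point is covered.\<close>

definition induced :: "'b::topological_space set \<Rightarrow> ((real \<Rightarrow> 'a) \<Rightarrow> (real \<Rightarrow> 'b)) \<Rightarrow> (real \<Rightarrow> 'a) set \<Rightarrow> (real \<Rightarrow> 'b) set" where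
  "induced T \<Phi> A = {h. \<exists>g\<in>A. homotopic_paths T (\<Phi> g) h}"

lemma induced_class:
  assumes "g \<in> loops S x" "\<And>h. homotopic_paths S g h \<Longrightarrow> homotopic_paths T (\<Phi> g) (\<Phi> h)"
  shows "induced T \<Phi> (loop_class S g) = loop_class T (\<Phi> g)"
  using assms loop_class_mem[OF assms(1)] unfolding induced_def loop_class_def
  by (blast intro: homotopic_paths_trans)

lemma induced_hom:
  assumes maps: "\<And>g. g \<in> loops S x \<Longrightarrow> \<Phi> g \<in> loops T y"
    and homotopic: "\<And>g h. g \<in> loops S x \<Longrightarrow> homotopic_paths S g h \<Longrightarrow> homotopic_paths T (\<Phi> g) (\<Phi> h)"
    and join: "\<And>g h. g \<in> loops S x \<Longrightarrow> h \<in> loops S x \<Longrightarrow> homotopic_paths T (\<Phi> (g +++ h)) (\<Phi> g +++ \<Phi> h)"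
  shows "induced T \<Phi> \<in> hom (fundamental_group S x) (fundamental_group T y)"
proof (rule homI)
  fix A assume "A \<in> carrier (fundamental_group S x)"
  then obtain f where A: "A = loop_class S f" and f: "f \<in> loops S x"
    unfolding carrier_fundamental_group by blast
  have A': "induced T \<Phi> A = loop_class T (\<Phi> f)" unfolding A by (rule induced_class) (use f homotopic in auto)
  then show "induced T \<Phi> A \<in> carrier (fundamental_group T y)"
    using maps[OF f] by (simp add: carrier_fundamental_group)
  fix B assume "B \<in> carrier (fundamental_group S x)"
  then obtain g where B: "B = loop_class S g" and g: "g \<in> loops S x"
    unfolding carrier_fundamental_group by blast
  have B': "induced T \<Phi> B = loop_class T (\<Phi> g)" unfolding B by (rule induced_class) (use g homotopic in auto)
  have fg: "f +++ g \<in> loops S x" using f g by simp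
  have "induced T \<Phi> (loop_class S (f +++ g)) = loop_class T (\<Phi> (f +++ g))"
    by (rule induced_class) (use fg homotopic in auto)
  then show "induced T \<Phi> (A \<otimes>\<^bsub>fundamental_group S x\<^esub> B) = induced T \<Phi> A \<otimes>\<^bsub>fundamental_group T y\<^esub> induced T \<Phi> B"
    unfolding A' B' fundamental_group_mult[OF maps[OF f] maps[OF g]]
    using loop_class_eq[OF join[OF f g]] by (simp add: A B fundamental_group_mult[OF f g])
qed

text \<open>The change of base point from the start to the end of the path \<open>d\<close>.\<close>

definition conjugate_loop :: "(real \<Rightarrow> 'a::topological_space) \<Rightarrow> (real \<Rightarrow> 'a) \<Rightarrow> real \<Rightarrow> 'a" where
  "conjugate_loop d g = reversepath d +++ (g +++ d)"

context
  fixes T :: "'b::topological_space set" and d x y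
  assumes d: "path d" "path_image d \<subseteq> T" "pathstart d = x" "pathfinish d = y"
begin

lemma conjugate_loop_loops: "g \<in> loops T x \<Longrightarrow> conjugate_loop d g \<in> loops T y"
  using d by (auto simp: loops_def conjugate_loop_def path_image_join)

lemma conjugate_loop_homotopic:
  assumes "homotopic_paths T g h" "g \<in> loops T x"
  shows "homotopic_paths T (conjugate_loop d g) (conjugate_loop d h)"
  unfolding conjugate_loop_def
  using assms d by (intro homotopic_paths_join) (auto simp: loops_def)

lemma conjugate_loop_join:
  assumes f: "f \<in> loops T x" and g: "g \<in> loops T x"
  shows "homotopic_paths T (conjugate_loop d (f +++ g)) (conjugate_loop d f +++ conjugate_loop d g)"
proof -
  let ?d = "reversepath d"
  have fs: "path f" "path_image f \<subseteq> T" "pathstart f = x" "pathfinish f = x"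
    and gs: "path g" "path_image g \<subseteq> T" "pathstart g = x" "pathfinish g = x"
    using f g by (auto simp: loops_def)
  note [simp] = d fs gs subset_path_image_join
  have "homotopic_paths T (conjugate_loop d f +++ conjugate_loop d g) (?d +++ ((f +++ d) +++ (?d +++ (g +++ d))))"
    unfolding conjugate_loop_def by (rule homotopic_paths_sym, rule homotopic_paths_assoc) simp_all
  also have "homotopic_paths T \<dots> (?d +++ (f +++ (d +++ (?d +++ (g +++ d)))))"
    by (intro homotopic_paths_join homotopic_paths_sym[OF homotopic_paths_assoc]) simp_all
  also have "homotopic_paths T \<dots> (?d +++ (f +++ (g +++ d)))"
    by (intro homotopic_paths_join cancel_reversepath) simp_all
  also have "homotopic_paths T \<dots> (conjugate_loop d (f +++ g))"
    unfolding conjugate_loop_def by (intro homotopic_paths_join homotopic_paths_assoc) simp_all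
  finally show ?thesis by (rule homotopic_paths_sym)
qed

lemma conjugate_loop_surj:
  assumes g: "g \<in> loops T y"
  shows "homotopic_paths T (conjugate_loop d (conjugate_loop (reversepath d) g)) g"
proof -
  let ?d = "reversepath d"
  have gs: "path g" "path_image g \<subseteq> T" "pathstart g = y" "pathfinish g = y"
    using g by (auto simp: loops_def)
  note [simp] = d gs subset_path_image_join
  have "homotopic_paths T (?d +++ ((d +++ (g +++ ?d)) +++ d)) (?d +++ (d +++ ((g +++ ?d) +++ d)))"
    by (rule homotopic_paths_join[OF _ homotopic_paths_sym[OF homotopic_paths_assoc]]) simp_all
  also have "homotopic_paths T \<dots> ((g +++ ?d) +++ d)"
    by (rule cancel_reversepath') simp_all
  also have "homotopic_paths T \<dots> (g +++ (?d +++ d))"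
    by (rule homotopic_paths_sym[OF homotopic_paths_assoc]) simp_all
  also have "homotopic_paths T \<dots> (g +++ (\<lambda>_. y))"
    using homotopic_paths_join_reversepath[of ?d T] by (intro homotopic_paths_join) simp_all
  also have "homotopic_paths T \<dots> g"
    by (rule homotopic_paths_const_right) simp_all
  finally show ?thesis by (simp add: conjugate_loop_def)
qed

end

section \<open>Pushing paths off a set\<close>

text \<open>The grid is finer than a Lebesgue number of the cover of the interval by the two preimages.\<close>

lemma path_partition_two_open:
  assumes \<gamma>: "path \<gamma>" "path_image \<gamma> \<subseteq> U1 \<union> U2"
    and U: "openin (top_of_set (U1 \<union> U2)) U1" "openin (top_of_set (U1 \<union> U2)) U2"
  obtains n :: nat where "n > 0"
    "\<And>i. i < n \<Longrightarrow> \<gamma> ` {real i / n .. real (Suc i) / n} \<subseteq> U1 \<or> \<gamma> ` {real i / n .. real (Suc i) / n} \<subseteq> U2"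
proof -
  have cont: "continuous_on {0..1} \<gamma>" using \<gamma> by (simp add: path_def)
  have "\<exists>O'. open O' \<and> {t \<in> {0..1}. \<gamma> t \<in> U} = {0..1} \<inter> O'" if "openin (top_of_set (U1 \<union> U2)) U" for U
  proof -
    have "openin (top_of_set {0..1}) ({0..1} \<inter> \<gamma> -` U)"
      using cont \<gamma>(2) that by (intro continuous_openin_preimage) (auto simp: path_image_def)
    then obtain O' where "open O'" "{0..1} \<inter> \<gamma> -` U = {0..1} \<inter> O'" by (auto simp: openin_open)
    moreover have "{t \<in> {0..1}. \<gamma> t \<in> U} = {0..1} \<inter> \<gamma> -` U" by auto
    ultimately show ?thesis by metis
  qed
  from this[OF U(1)] this[OF U(2)] obtain O1 O2 where
    O: "open O1" "{t \<in> {0..1}. \<gamma> t \<in> U1} = {0..1} \<inter> O1" "open O2" "{t \<in> {0..1}. \<gamma> t \<in> U2} = {0..1} \<inter> O2" by blast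
  have "{0..1} \<subseteq> O1 \<union> O2"
  proof
    fix t :: real assume t: "t \<in> {0..1}"
    then have "\<gamma> t \<in> U1 \<union> U2" using \<gamma>(2) unfolding path_image_def by blast
    then show "t \<in> O1 \<union> O2" using t O by blast
  qed
  then obtain e where e: "e > 0" "\<And>t. t \<in> {0..1} \<Longrightarrow> \<exists>G\<in>{O1, O2}. ball t e \<subseteq> G"
    using Heine_Borel_lemma[of "{0..1::real}" "{O1, O2}"] O(1,3) by auto
  obtain m :: nat where "inverse (real (Suc m)) < e"
    using reals_Archimedean[OF e(1)] by blast
  then have "\<exists>n>0. 1 / real n < e" by (intro exI[of _ "Suc m"]) (simp add: inverse_eq_divide)
  then obtain n :: nat where n: "n > 0" "1 / real n < e" by blast
  show ?thesis
  proof (rule that[OF n(1)])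
    fix i assume i: "i < n"
    have "0 \<le> real i / n" by simp
    moreover have "real i / n \<le> real (Suc i) / n" by (intro divide_right_mono) auto
    moreover have "real (Suc i) / n \<le> 1" using i by (simp add: divide_le_eq_1)
    ultimately have sub: "{real i / n .. real (Suc i) / n} \<subseteq> {0..1}" and t: "real i / n \<in> {0..1}"
      by auto
    have "{real i / n .. real (Suc i) / n} \<subseteq> ball (real i / n) e"
    proof
      fix t assume t: "t \<in> {real i / n .. real (Suc i) / n}"
      have "real (Suc i) / n = real i / n + 1 / n" by (simp add: add_divide_distrib)
      then have "\<bar>real i / n - t\<bar> \<le> 1 / n" using t unfolding atLeastAtMost_iff by linarith
      then show "t \<in> ball (real i / n) e" using n(2) unfolding mem_ball dist_real_def by linarith
    qed
    then have "{real i / n .. real (Suc i) / n} \<subseteq> O1 \<or> {real i / n .. real (Suc i) / n} \<subseteq> O2"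
      using e(2)[OF t] by blast
    then show "\<gamma> ` {real i / n .. real (Suc i) / n} \<subseteq> U1 \<or> \<gamma> ` {real i / n .. real (Suc i) / n} \<subseteq> U2"
      using sub O by blast
  qed
qed

text \<open>The path is followed along a fine grid. What has been traversed so far is kept, up to homotopy, as a
path \<open>\<alpha>\<close> in \<open>U1\<close> followed by a path \<open>\<beta>\<close> in one of the two sets. Whenever the current point lies in \<open>U1\<close>,
the assumption \<open>push\<close> replaces \<open>\<beta>\<close> by a path in \<open>U1\<close>, and \<open>\<alpha>\<close> absorbs it. At a point outside of \<open>U1\<close>
both \<open>\<beta>\<close> and the next piece lie in \<open>U2\<close> and are joined.\<close>

lemma push_path_into_open:
  assumes U: "openin (top_of_set (U1 \<union> U2)) U1" "openin (top_of_set (U1 \<union> U2)) U2"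
    and push: "\<And>\<beta>. path \<beta> \<Longrightarrow> path_image \<beta> \<subseteq> U2 \<Longrightarrow> pathstart \<beta> \<in> U1 \<Longrightarrow> pathfinish \<beta> \<in> U1 \<Longrightarrow>
        \<exists>\<beta>'. path_image \<beta>' \<subseteq> U1 \<and> homotopic_paths (U1 \<union> U2) \<beta> \<beta>'"
    and \<gamma>: "path \<gamma>" "path_image \<gamma> \<subseteq> U1 \<union> U2" "pathstart \<gamma> \<in> U1" "pathfinish \<gamma> \<in> U1"
  obtains \<gamma>' where "path_image \<gamma>' \<subseteq> U1" "homotopic_paths (U1 \<union> U2) \<gamma> \<gamma>'"
proof -
  let ?hom = "homotopic_paths (U1 \<union> U2)"
  let ?good = "\<lambda>t \<alpha> \<beta>. path \<alpha> \<and> path_image \<alpha> \<subseteq> U1 \<and> path \<beta> \<and> (path_image \<beta> \<subseteq> U1 \<or> path_image \<beta> \<subseteq> U2) \<and>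
     pathfinish \<alpha> = pathstart \<beta> \<and> ?hom (\<gamma> \<circ> linepath 0 t) (\<alpha> +++ \<beta>)"
  \<comment> \<open>The piece \<open>\<beta>\<close> can be absorbed when it ends in \<open>U1\<close>.\<close>
  have absorb: "\<exists>\<gamma>'. path \<gamma>' \<and> path_image \<gamma>' \<subseteq> U1 \<and> ?hom (\<gamma> \<circ> linepath 0 t) \<gamma>'"
    if g: "?good t \<alpha> \<beta>" "\<gamma> t \<in> U1" for t \<alpha> \<beta>
  proof -
    have "pathfinish \<beta> = \<gamma> t"
      using homotopic_paths_imp_pathfinish[of "U1 \<union> U2" "\<gamma> \<circ> linepath 0 t" "\<alpha> +++ \<beta>"] g by (simp add: pathfinish_compose)
    moreover have "pathstart \<beta> \<in> U1"
      using g pathfinish_in_path_image[of \<alpha>] by auto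
    ultimately have "\<exists>\<beta>'. path_image \<beta>' \<subseteq> U1 \<and> ?hom \<beta> \<beta>'" if "path_image \<beta> \<subseteq> U2"
      using g push[of \<beta>] that by simp
    moreover have "\<exists>\<beta>'. path_image \<beta>' \<subseteq> U1 \<and> ?hom \<beta> \<beta>'" if "path_image \<beta> \<subseteq> U1"
      using g that by (intro exI[of _ \<beta>]) auto
    ultimately obtain \<beta>' where \<beta>': "path_image \<beta>' \<subseteq> U1" "?hom \<beta> \<beta>'"
      using g by blast
    have "?hom (\<alpha> +++ \<beta>) (\<alpha> +++ \<beta>')"
      using that \<beta>' by (intro homotopic_paths_join) auto
    then have "?hom (\<gamma> \<circ> linepath 0 t) (\<alpha> +++ \<beta>')" using that homotopic_paths_trans by blast
    moreover have "path_image (\<alpha> +++ \<beta>') \<subseteq> U1"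
      using \<beta>' that by (intro subset_path_image_join) auto
    ultimately show ?thesis using homotopic_paths_imp_path by blast
  qed
  obtain n :: nat where n: "n > 0"
    "\<And>i. i < n \<Longrightarrow> \<gamma> ` {real i / n .. real (Suc i) / n} \<subseteq> U1 \<or> \<gamma> ` {real i / n .. real (Suc i) / n} \<subseteq> U2"
    using path_partition_two_open[OF \<gamma>(1,2) U] by blast
  have "\<exists>\<alpha> \<beta>. ?good (real i / n) \<alpha> \<beta>" if "i \<le> n" for i
    using that
  proof (induction i)
    case 0
    let ?c = "\<lambda>_::real. pathstart \<gamma>"
    have "?c +++ ?c = ?c" "\<gamma> \<circ> linepath 0 0 = ?c"
      by (auto simp: fun_eq_iff joinpaths_def pathstart_def linepath_def)
    moreover have "path ?c" by (simp add: path_def)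
    moreover have "path_image ?c \<subseteq> U1" using \<gamma> by (auto simp: path_image_def)
    moreover have "pathfinish ?c = pathstart ?c" by (simp add: pathfinish_def pathstart_def)
    ultimately have "?good (real 0 / n) ?c ?c" by (simp add: le_supI1)
    then show ?case by blast
  next
    case (Suc i)
    let ?s = "real i / n" and ?t = "real (Suc i) / n"
    have st: "0 \<le> ?s" "?s \<le> ?t" "?t \<le> 1"
      using Suc.prems n(1) by (simp_all add: divide_right_mono divide_le_eq_1)
    have "i \<le> n" using Suc.prems by simp
    then obtain \<alpha> \<beta> where good: "?good ?s \<alpha> \<beta>" using Suc.IH by blast
    let ?\<delta> = "\<gamma> \<circ> linepath ?s ?t"
    have cont: "continuous_on {0..1} \<gamma>" using \<gamma>(1) by (simp add: path_def)
    have \<delta>: "path ?\<delta>" "path_image ?\<delta> = \<gamma> ` {?s..?t}" "path_image ?\<delta> \<subseteq> U1 \<union> U2"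
    proof -
      have sub: "{?s..?t} \<subseteq> {0..1}" using st by (simp del: of_nat_Suc)
      show "path_image ?\<delta> = \<gamma> ` {?s..?t}"
        using st(2) by (simp add: path_image_compose closed_segment_eq_real_ivl)
      moreover have "\<gamma> ` {?s..?t} \<subseteq> U1 \<union> U2" using \<gamma>(2) sub unfolding path_image_def by blast
      ultimately show "path_image ?\<delta> \<subseteq> U1 \<union> U2" by simp
      show "path ?\<delta>"
        using sub st(2)
        by (intro path_continuous_image[OF path_linepath continuous_on_subset[OF cont]])
          (simp add: closed_segment_eq_real_ivl)
    qed
    have \<delta>s: "pathstart ?\<delta> = \<gamma> ?s" by (simp add: pathstart_compose)
    have join: "?hom (\<gamma> \<circ> linepath 0 ?t) ((\<gamma> \<circ> linepath 0 ?s) +++ ?\<delta>)"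
    proof -
      have "?hom (\<gamma> \<circ> linepath 0 ?t) (\<gamma> \<circ> (linepath 0 ?s +++ linepath ?s ?t))"
        using st \<gamma>(1,2)
        by (intro homotopic_paths_factor_interval) (auto simp: path_image_join closed_segment_eq_real_ivl)
      then show ?thesis by (simp add: path_compose_join)
    qed
    have \<beta>f: "pathfinish \<beta> = \<gamma> ?s"
      using homotopic_paths_imp_pathfinish[of "U1 \<union> U2" "\<gamma> \<circ> linepath 0 ?s" "\<alpha> +++ \<beta>"] good by (simp add: pathfinish_compose)
    have inU1: ?case if s1: "\<gamma> ?s \<in> U1" and \<delta>12: "path_image ?\<delta> \<subseteq> U1 \<or> path_image ?\<delta> \<subseteq> U2"
    proof -
      obtain \<alpha>' where \<alpha>': "path \<alpha>'" "path_image \<alpha>' \<subseteq> U1" "?hom (\<gamma> \<circ> linepath 0 ?s) \<alpha>'"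
        using absorb[OF good s1] by blast
      have fin: "pathfinish \<alpha>' = \<gamma> ?s" using homotopic_paths_imp_pathfinish[OF \<alpha>'(3)] by (simp add: pathfinish_compose)
      have "?hom ((\<gamma> \<circ> linepath 0 ?s) +++ ?\<delta>) (\<alpha>' +++ ?\<delta>)"
        using \<alpha>' \<delta> \<delta>s fin by (intro homotopic_paths_join) (auto simp: pathfinish_compose)
      then have "?good ?t \<alpha>' ?\<delta>"
        using \<alpha>' \<delta>(1) \<delta>s fin \<delta>12 homotopic_paths_trans[OF join] by simp
      then show ?case by blast
    qed
    show ?case
    proof (cases "\<gamma> ?s \<in> U1")
      case True
      moreover have "path_image ?\<delta> \<subseteq> U1 \<or> path_image ?\<delta> \<subseteq> U2"
        unfolding \<delta>(2) by (rule n(2)) (use Suc.prems in simp)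
      ultimately show ?thesis by (rule inU1)
    next
      case False
      then have \<beta>2: "path_image \<beta> \<subseteq> U2"
        using good \<beta>f pathfinish_in_path_image[of \<beta>] by auto
      have \<delta>2: "path_image ?\<delta> \<subseteq> U2"
      proof -
        have "?s \<in> {?s..?t}" using st(2) by simp
        then have "\<not> \<gamma> ` {?s..?t} \<subseteq> U1" using False by blast
        then show ?thesis unfolding \<delta>(2) using n(2)[of i] Suc.prems by simp
      qed
      have "?hom ((\<gamma> \<circ> linepath 0 ?s) +++ ?\<delta>) ((\<alpha> +++ \<beta>) +++ ?\<delta>)"
        using good \<delta> \<delta>s by (intro homotopic_paths_join) (auto simp: pathfinish_compose)
      moreover have "?hom ((\<alpha> +++ \<beta>) +++ ?\<delta>) (\<alpha> +++ (\<beta> +++ ?\<delta>))"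
        using good \<delta> \<delta>s \<beta>f \<beta>2 by (intro homotopic_paths_sym[OF homotopic_paths_assoc]) auto
      ultimately have "?hom (\<gamma> \<circ> linepath 0 ?t) (\<alpha> +++ (\<beta> +++ ?\<delta>))"
        using join homotopic_paths_trans by blast
      then have "?good ?t \<alpha> (\<beta> +++ ?\<delta>)"
        using good \<delta> \<delta>s \<beta>f \<beta>2 \<delta>2 by (simp add: subset_path_image_join)
      then show ?thesis by blast
    qed
  qed
  note all = this
  have one: "real n / real n = 1" using n(1) by simp
  obtain \<alpha> \<beta> where good: "?good 1 \<alpha> \<beta>" using all[of n] unfolding one by blast
  have "\<gamma> 1 \<in> U1" using \<gamma>(4) by (simp add: pathfinish_def)
  then obtain \<gamma>' where "path_image \<gamma>' \<subseteq> U1" "?hom (\<gamma> \<circ> linepath 0 1) \<gamma>'"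
    using absorb[OF good] by blast
  then show ?thesis using that[of \<gamma>'] compose_linepath_01[OF \<gamma>(1)] by simp
qed

section \<open>Attaching a solid torus\<close>

abbreviation solid_torus :: "(complex \<times> complex) set" where
  "solid_torus \<equiv> cball 0 1 \<times> sphere 0 1"

text \<open>This serves for two decompositions: the sphere into a knot exterior and a tube around the knot, and
the surgered manifold into the same exterior and the new solid torus. Compactness
makes \<open>e\<close> a homeomorphism onto a closed set, so maps out of \<open>Z\<close> can be defined piecewise.\<close>

locale solid_torus_attached =
  fixes Z P :: "'a::t2_space set" and e :: "complex \<times> complex \<Rightarrow> 'a"
  assumes P: "compact P" and e: "continuous_on solid_torus e" "inj_on e solid_torus"
    and Z: "Z = P \<union> e ` solid_torus"
    and boundary: "P \<inter> e ` solid_torus = e ` (sphere 0 1 \<times> sphere 0 1)"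
begin

definition core :: "'a set" where "core = e ` ({0} \<times> sphere 0 1)"

text \<open>For \<open>s\<close> from \<open>0\<close> to \<open>1\<close> this deforms the complement of the core onto \<open>P\<close>, by moving the disc coordinate
\<open>z\<close> along its ray to the boundary circle.\<close>

definition radial :: "real \<Rightarrow> 'a \<Rightarrow> 'a" where
  "radial s x = (if x \<in> P then x else
     case inv_into solid_torus e x of (z, w) \<Rightarrow> e ((1 - s) *\<^sub>R z + s *\<^sub>R sgn z, w))"

lemma compact_solid_torus: "compact solid_torus"
  by (intro compact_Times) auto

lemma inv_into_e: "v \<in> solid_torus \<Longrightarrow> inv_into solid_torus e (e v) = v"
  using e(2) by (rule inv_into_f_f)

lemma continuous_inv_into_e: "continuous_on (e ` solid_torus) (inv_into solid_torus e)"
  by (rule continuous_on_inv[OF e(1) compact_solid_torus]) (use inv_into_e in blast)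

lemma e_in_P_iff:
  assumes "norm z \<le> 1" "norm w = 1"
  shows "e (z, w) \<in> P \<longleftrightarrow> norm z = 1"
proof
  assume "e (z, w) \<in> P"
  then have "e (z, w) \<in> e ` (sphere 0 1 \<times> sphere 0 1)" using assms boundary by auto
  then obtain v where "v \<in> sphere 0 1 \<times> sphere 0 1" "e (z, w) = e v" by blast
  moreover have "(z, w) \<in> solid_torus" using assms by auto
  ultimately have "(z, w) = v" using e(2) by (auto dest: inj_onD)
  then show "norm z = 1" using \<open>v \<in> _\<close> by auto
next
  assume "norm z = 1"
  then have "e (z, w) \<in> e ` (sphere 0 1 \<times> sphere 0 1)" using assms by (intro imageI) auto
  then show "e (z, w) \<in> P" using boundary by blast
qed

lemma e_in_core_iff:
  assumes "norm z \<le> 1" "norm w = 1"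
  shows "e (z, w) \<in> core \<longleftrightarrow> z = 0"
proof
  assume "e (z, w) \<in> core"
  then obtain w' where "w' \<in> sphere 0 1" "e (z, w) = e (0, w')" by (auto simp: core_def)
  moreover have "(z, w) \<in> solid_torus" using assms by auto
  ultimately show "z = 0" using e(2) by (auto dest: inj_onD)
qed (use assms in \<open>auto simp: core_def\<close>)

lemma P_disjoint_core: "P \<inter> core = {}"
  using e_in_P_iff by (auto simp: core_def)

lemma cases_Z [consumes 1, case_names in_P interior]:
  assumes "x \<in> Z"
  obtains "x \<in> P" | z w where "norm z < 1" "norm w = 1" "x = e (z, w)"
proof (cases "x \<in> P")
  case False
  then obtain z w where zw: "norm z \<le> 1" "norm w = 1" "x = e (z, w)" using assms by (auto simp: Z)
  then have "norm z < 1" using False e_in_P_iff by (metis le_less)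
  then show ?thesis using that zw by blast
qed

lemma radial_e:
  assumes "norm z \<le> 1" "norm w = 1"
  shows "radial s (e (z, w)) = e ((1 - s) *\<^sub>R z + s *\<^sub>R sgn z, w)"
proof (cases "norm z = 1")
  case True
  then have "sgn z = z" by (simp add: sgn_div_norm)
  then show ?thesis using True assms by (simp add: radial_def e_in_P_iff scaleR_left_distrib[symmetric])
next
  case False
  then show ?thesis using assms inv_into_e[of "(z, w)"] by (simp add: radial_def e_in_P_iff)
qed

lemma radial_P [simp]: "x \<in> P \<Longrightarrow> radial s x = x"
  by (simp add: radial_def)

lemma norm_radial:
  fixes z :: complex
  assumes "z \<noteq> 0" "0 \<le> s" "s \<le> 1"
  shows "norm ((1 - s) *\<^sub>R z + s *\<^sub>R sgn z) = (1 - s) * norm z + s"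
proof -
  have "(1 - s) *\<^sub>R z + s *\<^sub>R sgn z = ((1 - s) * norm z + s) *\<^sub>R sgn z"
    using assms by (simp add: sgn_div_norm algebra_simps)
  then show ?thesis using assms by (simp add: norm_sgn)
qed

lemma radial_in:
  assumes "x \<in> Z - core" "0 \<le> s" "s \<le> 1"
  shows "radial s x \<in> Z - core"
proof -
  have "x \<in> Z" using assms by simp
  then show ?thesis
  proof (cases rule: cases_Z)
    case in_P
    then show ?thesis using assms by simp
  next
    case 2: (interior z w)
  then have z: "z \<noteq> 0" using assms e_in_core_iff by auto
  let ?z = "(1 - s) *\<^sub>R z + s *\<^sub>R sgn z"
  have "norm ?z \<le> 1"
    using 2 assms norm_radial[OF z assms(2,3)] mult_left_mono[of "norm z" 1 "1 - s"] by simp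
  moreover have "?z \<noteq> 0"
  proof -
    have "(1 - s) * norm z + s > 0"
      using z assms by (cases "s = 0") (auto intro: add_nonneg_pos)
    then show ?thesis using norm_radial[OF z assms(2,3)] by auto
  qed
  ultimately show ?thesis
    using 2 radial_e[of z w s] e_in_core_iff[of ?z w] by (auto simp: Z)
  qed
qed

lemma radial_1_in_P:
  assumes "x \<in> Z - core"
  shows "radial 1 x \<in> P"
proof -
  have "x \<in> Z" using assms by simp
  then show ?thesis
  proof (cases rule: cases_Z)
    case 2: (interior z w)
  then have z: "z \<noteq> 0" using assms e_in_core_iff by auto
  then show ?thesis using 2 radial_e[of z w 1] e_in_P_iff[of "sgn z" w] by (simp add: norm_sgn)
  qed simp
qed

lemma radial_0: "x \<in> Z - core \<Longrightarrow> radial 0 x = x"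
  by (erule DiffE, erule cases_Z) (auto simp: radial_e)

text \<open>The two closed pieces fit together on the bounding torus, where \<open>sgn z = z\<close> makes the formula for the
solid torus the identity.\<close>

lemma continuous_radial: "continuous_on ({0..1} \<times> (Z - core)) (\<lambda>(s, x). radial s x)"
proof -
  let ?I = "{0..1::real}" and ?E = "e ` solid_torus - core"
  have Q: "?I \<times> (Z - core) = ?I \<times> P \<union> ?I \<times> ?E"
    using P_disjoint_core by (auto simp: Z)
  have closed: "closed P" "closed (e ` solid_torus)"
    using P compact_continuous_image[OF e(1) compact_solid_torus] by (auto intro: compact_imp_closed)
  have "?I \<times> P = (?I \<times> (Z - core)) \<inter> (?I \<times> P)" "?I \<times> ?E = (?I \<times> (Z - core)) \<inter> (?I \<times> e ` solid_torus)"
    using P_disjoint_core by (auto simp: Z)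
  then have cl: "closedin (top_of_set (?I \<times> (Z - core))) (?I \<times> P)"
      "closedin (top_of_set (?I \<times> (Z - core))) (?I \<times> ?E)"
    using closed by (metis closedin_closed_Int closed_Times closed_real_atLeastAtMost)+
  have "continuous_on (?I \<times> P) (\<lambda>(s, x). radial s x)"
    by (rule continuous_on_eq[of _ snd]) (auto intro: continuous_intros)
  moreover have "continuous_on (?I \<times> ?E) (\<lambda>(s, x). radial s x)"
  proof -
    let ?g = "\<lambda>(s, x). case inv_into solid_torus e x of (z, w) \<Rightarrow> ((1 - s) *\<^sub>R z + s *\<^sub>R sgn z, w)"
    have inv: "continuous_on (?I \<times> ?E) (\<lambda>y. inv_into solid_torus e (snd y))"
      by (rule continuous_on_compose2[OF continuous_inv_into_e]) (auto intro: continuous_intros)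
    have nz: "fst (inv_into solid_torus e (snd y)) \<noteq> 0" if "y \<in> ?I \<times> ?E" for y
      using that by (auto simp: inv_into_e core_def)
    have g: "continuous_on (?I \<times> ?E) ?g"
      unfolding split_beta
      by (intro continuous_intros inv continuous_on_sgn) (use nz in auto)
    have "?g ` (?I \<times> ?E) \<subseteq> solid_torus"
    proof
      fix v assume "v \<in> ?g ` (?I \<times> ?E)"
      then obtain s z w where v: "0 \<le> s" "s \<le> 1" "norm z \<le> 1" "norm w = 1" "e (z, w) \<notin> core"
        "v = ((1 - s) *\<^sub>R z + s *\<^sub>R sgn z, w)"
        by (auto simp: inv_into_e)
      then have "z \<noteq> 0" using e_in_core_iff by auto
      then show "v \<in> solid_torus"
        using v norm_radial[of z s] mult_left_mono[of "norm z" 1 "1 - s"] by simp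
    qed
    then have "continuous_on (?I \<times> ?E) (\<lambda>y. e (?g y))"
      by (intro continuous_on_compose2[OF e(1) g])
    then show ?thesis
      by (rule continuous_on_eq) (auto simp: radial_e inv_into_e)
  qed
  ultimately show ?thesis
    using cl unfolding Q by (intro continuous_on_Un_local)
qed

lemma continuous_radial_1: "continuous_on (Z - core) (radial 1)"
proof -
  have "continuous_on (Z - core) (\<lambda>x. case (1, x) of (s, x) \<Rightarrow> radial s x)"
    by (rule continuous_on_compose2[OF continuous_radial]) (auto intro: continuous_intros)
  then show ?thesis by simp
qed

lemma homotopic_radial:
  assumes \<gamma>: "path \<gamma>" "path_image \<gamma> \<subseteq> Z - core" "pathstart \<gamma> \<in> P" "pathfinish \<gamma> \<in> P"
  shows "homotopic_paths (Z - core) \<gamma> (radial 1 \<circ> \<gamma>)"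
proof -
  let ?h = "\<lambda>(s, t). radial s (\<gamma> t)"
  have \<gamma>t: "\<gamma> t \<in> Z - core" if "t \<in> {0..1}" for t using \<gamma>(2) that unfolding path_image_def by blast
  have c: "continuous_on ({0..1} \<times> {0..1}) (\<lambda>y. \<gamma> (snd y))"
    by (rule continuous_on_compose2[of "{0..1}" \<gamma>]) (use \<gamma> in \<open>auto simp: path_def intro: continuous_intros\<close>)
  have "continuous_on ({0..1} \<times> {0..1}) (\<lambda>y. case (fst y, \<gamma> (snd y)) of (s, x) \<Rightarrow> radial s x)"
    by (rule continuous_on_compose2[OF continuous_radial]) (use \<gamma>t c in \<open>auto intro!: continuous_intros\<close>)
  then have "continuous_on ({0..1} \<times> {0..1}) ?h" by (simp add: split_beta)
  moreover have "?h \<in> ({0..1} \<times> {0..1}) \<rightarrow> Z - core" using \<gamma>t radial_in by fastforce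
  ultimately show ?thesis
    unfolding homotopic_paths using \<gamma> \<gamma>t
    by (intro exI[of _ ?h]) (auto simp: radial_0 pathstart_def pathfinish_def)
qed

text \<open>In the coordinates of the solid torus only the disc coordinate has to change: it is replaced by a
path in the punctured disc, to which it is homotopic because the disc is convex.\<close>

lemma push_off_core:
  assumes \<beta>: "path \<beta>" "path_image \<beta> \<subseteq> Z - P" "pathstart \<beta> \<notin> core" "pathfinish \<beta> \<notin> core"
  shows "\<exists>\<beta>'. path_image \<beta>' \<subseteq> Z - core \<and> homotopic_paths Z \<beta> \<beta>'"
proof -
  define \<zeta> where "\<zeta> t = inv_into solid_torus e (\<beta> t)" for t
  have \<zeta>: "norm (fst (\<zeta> t)) < 1" "norm (snd (\<zeta> t)) = 1" "e (\<zeta> t) = \<beta> t" if "t \<in> {0..1}" for t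
  proof -
    have "\<beta> t \<in> Z - P" using \<beta>(2) that unfolding path_image_def by blast
    then obtain z w where "norm z < 1" "norm w = 1" "\<beta> t = e (z, w)" using cases_Z[of "\<beta> t"] by blast
    then show "norm (fst (\<zeta> t)) < 1" "norm (snd (\<zeta> t)) = 1" "e (\<zeta> t) = \<beta> t"
      by (simp_all add: \<zeta>_def inv_into_e)
  qed
  have cont: "continuous_on {0..1} \<zeta>"
    unfolding \<zeta>_def
    by (rule continuous_on_compose2[OF continuous_inv_into_e]) (use \<beta> in \<open>auto simp: path_def path_image_def Z\<close>)
  let ?z = "fst \<circ> \<zeta>" and ?w = "snd \<circ> \<zeta>"
  have nz: "?z t \<in> ball 0 1 - {0}" if "t \<in> {0..1}" "\<beta> t \<notin> core" for t
  proof -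
    have "\<zeta> t = (fst (\<zeta> t), snd (\<zeta> t))" by simp
    then have "fst (\<zeta> t) \<noteq> 0" using \<zeta>[OF that(1)] that(2) e_in_core_iff by (metis le_less)
    then show ?thesis using \<zeta>[OF that(1)] by simp
  qed
  have "path_connected (ball (0::complex) 1 - {0})"
    by (rule path_connected_punctured_ball) simp
  moreover have "?z 0 \<in> ball 0 1 - {0}" "?z 1 \<in> ball 0 1 - {0}"
    using \<beta>(3,4) nz[of 0] nz[of 1] by (simp_all add: pathstart_def pathfinish_def)
  ultimately obtain z' where z': "path z'" "path_image z' \<subseteq> ball 0 1 - {0}" "pathstart z' = ?z 0" "pathfinish z' = ?z 1"
    unfolding path_connected_def by blast
  have z't: "norm (z' t) < 1" "z' t \<noteq> 0" if "t \<in> {0..1}" for t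
  proof -
    have "z' t \<in> ball 0 1 - {0}" using z'(2) that unfolding path_image_def by blast
    then show "norm (z' t) < 1" "z' t \<noteq> 0" by auto
  qed
  let ?\<zeta>' = "\<lambda>t. (z' t, ?w t)"
  have "homotopic_paths solid_torus \<zeta> ?\<zeta>'"
  proof (rule homotopic_paths_linear)
    show "path \<zeta>" using cont by (simp add: path_def)
    show "path ?\<zeta>'" using z'(1) cont unfolding path_def
      by (auto intro!: continuous_intros continuous_on_compose)
    show "pathstart ?\<zeta>' = pathstart \<zeta>" "pathfinish ?\<zeta>' = pathfinish \<zeta>"
      using z'(3,4) by (simp_all add: pathstart_def pathfinish_def)
    fix t :: real assume t: "t \<in> {0..1}"
    have "closed_segment (\<zeta> t) (?\<zeta>' t) \<subseteq> cball 0 1 \<times> {?w t}"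
      using \<zeta>[OF t] z't[OF t] by (intro closed_segment_subset convex_Times) (auto simp: mem_Times_iff)
    also have "\<dots> \<subseteq> solid_torus" using \<zeta>[OF t] by auto
    finally show "closed_segment (\<zeta> t) (?\<zeta>' t) \<subseteq> solid_torus" .
  qed
  then have "homotopic_paths Z (e \<circ> \<zeta>) (e \<circ> ?\<zeta>')"
    by (rule homotopic_paths_continuous_image) (use e in \<open>auto simp: Z\<close>)
  moreover have "homotopic_paths Z \<beta> (e \<circ> \<zeta>)"
    using \<beta> \<zeta> by (intro homotopic_paths_eq) auto
  moreover have "path_image (e \<circ> ?\<zeta>') \<subseteq> Z - core"
    using \<zeta> z't e_in_core_iff by (auto simp: path_image_def Z le_less)
  ultimately show ?thesis using homotopic_paths_trans by blast
qed

lemma closed_P_core: "closed P" "closed core"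
proof -
  have "compact core"
    unfolding core_def using e(1)
    by (intro compact_continuous_image compact_Times) (auto intro: continuous_on_subset)
  then show "closed P" "closed core" using P by (auto intro: compact_imp_closed)
qed

text \<open>Off the core the radial deformation is available and carries the path into \<open>P\<close>.\<close>

theorem push_into_P:
  assumes \<gamma>: "path \<gamma>" "path_image \<gamma> \<subseteq> Z" "pathstart \<gamma> \<in> P" "pathfinish \<gamma> \<in> P"
  obtains \<gamma>' where "path \<gamma>'" "path_image \<gamma>' \<subseteq> P" "homotopic_paths Z \<gamma> \<gamma>'"
proof -
  have Un: "(Z - core) \<union> (Z - P) = Z" using P_disjoint_core by blast
  have "openin (top_of_set Z) (Z - core)" "openin (top_of_set Z) (Z - P)"
    using closed_P_core by (auto simp: Diff_eq openin_open_Int open_Compl)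
  moreover have "pathstart \<gamma> \<in> Z - core" "pathfinish \<gamma> \<in> Z - core"
    using \<gamma> P_disjoint_core by (auto simp: Z)
  ultimately obtain \<gamma>1 where \<gamma>1: "path_image \<gamma>1 \<subseteq> Z - core" "homotopic_paths Z \<gamma> \<gamma>1"
    using push_path_into_open[of "Z - core" "Z - P" \<gamma>, unfolded Un] push_off_core \<gamma>(1,2)
    by (smt (verit) DiffD2)
  have "homotopic_paths (Z - core) \<gamma>1 (radial 1 \<circ> \<gamma>1)"
    using \<gamma>1 \<gamma> homotopic_paths_imp_path[OF \<gamma>1(2)] homotopic_paths_imp_pathstart[OF \<gamma>1(2)]
      homotopic_paths_imp_pathfinish[OF \<gamma>1(2)] by (intro homotopic_radial) auto
  then have hom: "homotopic_paths Z \<gamma>1 (radial 1 \<circ> \<gamma>1)" by (rule homotopic_paths_subset) auto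
  show ?thesis
  proof (rule that)
    show "path (radial 1 \<circ> \<gamma>1)" using hom homotopic_paths_imp_path by blast
    show "path_image (radial 1 \<circ> \<gamma>1) \<subseteq> P" using \<gamma>1(1) radial_1_in_P by (auto simp: path_image_def)
    show "homotopic_paths Z \<gamma> (radial 1 \<circ> \<gamma>1)" using \<gamma>1(2) hom by (rule homotopic_paths_trans)
  qed
qed

lemma path_connected_Z:
  assumes "path_connected P"
  shows "path_connected Z"
  unfolding Z
proof (rule path_connected_Un[OF assms])
  have "path_connected (sphere (0::complex) 1)" by (rule path_connected_sphere) simp
  then have "path_connected solid_torus"
    using path_connected_Times[OF convex_imp_path_connected[OF convex_cball]] by blast
  then show "path_connected (e ` solid_torus)"
    by (rule path_connected_continuous_image[OF e(1)])
  show "P \<inter> e ` solid_torus \<noteq> {}" by (simp add: boundary)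
qed

text \<open>The punctured tube around the core is connected, so it lies on one side of any separation of the
complement. Adding the core to this side would separate \<open>Z\<close>.\<close>

lemma connected_minus_core:
  assumes "connected Z"
  shows "connected (Z - core)"
proof (rule ccontr)
  let ?N = "e ` ((ball 0 1 - {0}) \<times> sphere 0 1)"
  assume "\<not> connected (Z - core)"
  then obtain A B where AB: "openin (top_of_set (Z - core)) A" "openin (top_of_set (Z - core)) B"
      "Z - core \<subseteq> A \<union> B" "A \<inter> B = {}" "A \<noteq> {}" "B \<noteq> {}"
    unfolding connected_openin by blast
  have N: "?N \<subseteq> Z - core" "Z - P \<subseteq> ?N \<union> core"
  proof -
    show "?N \<subseteq> Z - core" using e_in_core_iff by (auto simp: Z)
    show "Z - P \<subseteq> ?N \<union> core"
    proof
      fix x assume "x \<in> Z - P"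
      then obtain z w where x: "norm z < 1" "norm w = 1" "x = e (z, w)" using cases_Z[of x] by blast
      then show "x \<in> ?N \<union> core" by (cases "z = 0") (auto simp: core_def)
    qed
  qed
  have "connected (sphere (0::complex) 1)" "connected (ball (0::complex) 1 - {0})"
    by (auto intro: connected_sphere connected_punctured_ball)
  then have "connected ?N"
    using e(1) by (intro connected_continuous_image connected_Times) (auto intro: continuous_on_subset)
  moreover have "openin (top_of_set ?N) (?N \<inter> A)" "openin (top_of_set ?N) (?N \<inter> B)"
    using openin_subtopology_Int_subset[of "Z - core" A ?N] openin_subtopology_Int_subset[of "Z - core" B ?N]
      AB(1,2) N(1) openin_imp_subset[OF AB(1)] openin_imp_subset[OF AB(2)] by (simp_all add: Int_absorb1)
  ultimately have "?N \<inter> A = {} \<or> ?N \<inter> B = {}"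
    using N(1) AB(3,4) unfolding connected_openin by blast
  have openZ: "openin (top_of_set Z) (Z - core)" "openin (top_of_set Z) (Z - P)"
    using closed_P_core by (auto simp: Diff_eq openin_open_Int open_Compl)
  have "False" if "openin (top_of_set (Z - core)) A" "openin (top_of_set (Z - core)) B"
      "Z - core \<subseteq> A \<union> B" "A \<inter> B = {}" "A \<noteq> {}" "B \<noteq> {}" "?N \<inter> B = {}" for A B
  proof -
    have "openin (top_of_set Z) A" "openin (top_of_set Z) B"
      using that(1,2) openZ(1) openin_trans by blast+
    then have "openin (top_of_set Z) (A \<union> (Z - P))" using openZ(2) by blast
    moreover have "Z \<subseteq> (A \<union> (Z - P)) \<union> B" using that(3) P_disjoint_core by blast
    moreover have "(A \<union> (Z - P)) \<inter> B = {}"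
      using that(4,7) N(2) openin_imp_subset[OF that(2)] by blast
    ultimately show False
      using assms \<open>openin (top_of_set Z) B\<close> that(5,6) unfolding connected_openin by blast
  qed
  from this[of A B] this[of B A] AB \<open>?N \<inter> A = {} \<or> ?N \<inter> B = {}\<close> show False by blast
qed

end

section \<open>Stereographic projection\<close>

definition stereo_inv :: "(real^3) \<times> real \<Rightarrow> real^3" where
  "stereo_inv y = (1 / (1 - snd y)) *\<^sub>R fst y"

lemma norm_sq_plus_1_pos: "(norm (x::real^3))\<^sup>2 + 1 > 0"
  by (simp add: add_nonneg_pos)

lemma snd_stereo: "1 - snd (stereo x) = 2 / ((norm x)\<^sup>2 + 1)"
  using norm_sq_plus_1_pos[of x] by (simp add: stereo_def field_simps)

lemma stereo_inv_stereo [simp]: "stereo_inv (stereo x) = x"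
proof -
  have "stereo_inv (stereo x) = (1 / (2 / ((norm x)\<^sup>2 + 1)) * (2 / ((norm x)\<^sup>2 + 1))) *\<^sub>R x"
    unfolding stereo_inv_def snd_stereo by (simp add: stereo_def)
  also have "1 / (2 / ((norm x)\<^sup>2 + 1)) * (2 / ((norm x)\<^sup>2 + 1)) = 1"
    using norm_sq_plus_1_pos[of x] by (simp add: field_simps)
  finally show ?thesis by simp
qed

lemma inj_stereo: "inj stereo"
  by (rule inj_on_inverseI) (rule stereo_inv_stereo)

lemma stereo_in_S3: "stereo x \<in> S3"
proof -
  let ?n = "(norm x)\<^sup>2"
  have "(norm (stereo x))\<^sup>2 = (2 / (?n + 1))\<^sup>2 * ?n + ((?n - 1) / (?n + 1))\<^sup>2"
    by (simp add: stereo_def norm_Pair power_mult_distrib power_divide)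
  also have "\<dots> = ((2\<^sup>2 * ?n + (?n - 1)\<^sup>2)) / (?n + 1)\<^sup>2"
    by (simp add: power_divide add_divide_distrib)
  also have "2\<^sup>2 * ?n + (?n - 1)\<^sup>2 = (?n + 1)\<^sup>2" by (simp add: power2_eq_square algebra_simps)
  finally have "(norm (stereo x))\<^sup>2 = 1" using norm_sq_plus_1_pos[of x] by simp
  then have "norm (stereo x) = 1" using power2_eq_1_iff[of "norm (stereo x)"] norm_ge_zero[of "stereo x"] by linarith
  then show ?thesis by simp
qed

lemma stereo_stereo_inv:
  assumes "y \<in> S3" "snd y \<noteq> 1"
  shows "stereo (stereo_inv y) = y"
proof -
  obtain a t where y: "y = (a, t)" by (cases y)
  have at: "(norm a)\<^sup>2 + t\<^sup>2 = 1"
    using assms(1) by (simp add: y norm_Pair)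
  have "t\<^sup>2 \<le> 1" using at by (smt (verit) zero_le_power2)
  then have t: "t < 1" using assms(2) by (simp add: y abs_square_le_1)
  have "(norm (stereo_inv y))\<^sup>2 = (1 - t\<^sup>2) / (1 - t)\<^sup>2"
    using at by (simp add: y stereo_inv_def power_divide)
  also have "1 - t\<^sup>2 = (1 - t) * (1 + t)" by (simp add: power2_eq_square algebra_simps)
  also have "(1 - t) * (1 + t) / (1 - t)\<^sup>2 = (1 + t) / (1 - t)" using t by (simp add: power2_eq_square)
  finally have n: "(norm (stereo_inv y))\<^sup>2 = (1 + t) / (1 - t)" .
  have n1: "(norm (stereo_inv y))\<^sup>2 + 1 = 2 / (1 - t)" "(norm (stereo_inv y))\<^sup>2 - 1 = (2 * t) / (1 - t)"
    using t by (simp_all add: n field_simps)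
  show ?thesis
    unfolding stereo_def n1 using t by (simp add: y stereo_inv_def)
qed

lemma continuous_stereo: "continuous_on UNIV stereo"
  unfolding stereo_def
  by (intro continuous_intros) (use norm_sq_plus_1_pos in \<open>auto simp: less_imp_neq[symmetric]\<close>)

lemma open_stereo_image:
  assumes "open U"
  shows "openin (top_of_set S3) (stereo ` U)"
proof -
  let ?C = "{y :: (real^3) \<times> real. snd y \<noteq> 1}"
  have C: "open ?C"
  proof -
    have "?C = snd -` (- {1})" by auto
    then show ?thesis by (simp add: open_vimage_snd open_Compl)
  qed
  have "continuous_on ?C stereo_inv"
    unfolding stereo_inv_def by (intro continuous_intros) auto
  then have "open (?C \<inter> stereo_inv -` U)"
    using C assms by (rule continuous_open_preimage)
  moreover have "stereo ` U = S3 \<inter> (?C \<inter> stereo_inv -` U)"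
  proof (intro equalityI subsetI)
    fix y assume "y \<in> stereo ` U"
    then obtain x where "x \<in> U" "y = stereo x" by blast
    moreover have "snd (stereo x) \<noteq> 1" using snd_stereo[of x] norm_sq_plus_1_pos[of x] by auto
    ultimately show "y \<in> S3 \<inter> (?C \<inter> stereo_inv -` U)" using stereo_in_S3 by simp
  next
    fix y assume "y \<in> S3 \<inter> (?C \<inter> stereo_inv -` U)"
    then have "y = stereo (stereo_inv y)" "stereo_inv y \<in> U" using stereo_stereo_inv by auto
    then show "y \<in> stereo ` U" by blast
  qed
  ultimately show ?thesis by (auto simp: openin_open)
qed

section \<open>The tube around a knot\<close>

text \<open>A continuous map from a compact to a Hausdorff space is closed, hence a quotient map onto its image.\<close>

lemma continuous_on_factor_compact:
  fixes q :: "'a::topological_space \<Rightarrow> 'b::t2_space" and h :: "'b \<Rightarrow> 'c::topological_space"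
  assumes S: "compact S" and q: "continuous_on S q" and hq: "continuous_on S (\<lambda>x. h (q x))"
  shows "continuous_on (q ` S) h"
  unfolding continuous_on_closed_invariant
proof (intro allI impI)
  fix B :: "'c set" assume "closed B"
  then obtain A where A: "closed A" "A \<inter> S = (\<lambda>x. h (q x)) -` B \<inter> S"
    using hq unfolding continuous_on_closed_invariant by blast
  have "compact (S \<inter> A)" using S A(1) by (rule compact_Int_closed)
  then have "closed (q ` (S \<inter> A))"
    by (intro compact_imp_closed compact_continuous_image continuous_on_subset[OF q]) auto
  moreover have "q ` (S \<inter> A) \<inter> q ` S = h -` B \<inter> q ` S" using A(2) by blast
  ultimately show "\<exists>A. closed A \<and> A \<inter> q ` S = h -` B \<inter> q ` S" by blast
qed

lemma cis_eq_iff: "cis a = cis b \<longleftrightarrow> (\<exists>n::int. a = b + 2 * pi * of_int n)"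
proof -
  have "cis a = cis b \<longleftrightarrow> exp (\<i> * of_real a) = exp (\<i> * of_real b)" by (simp add: cis_conv_exp)
  also have "\<dots> \<longleftrightarrow> (\<exists>n::int. a = b + 2 * pi * of_int n)"
    unfolding exp_eq by (simp add: complex_eq_iff algebra_simps)
  finally show ?thesis .
qed

lemma cis_surj:
  assumes "norm w = 1"
  obtains t where "0 \<le> t" "t < 1" "w = cis (2 * pi * t)"
proof (rule that)
  show "0 \<le> Arg2pi w / (2 * pi)" "Arg2pi w / (2 * pi) < 1"
    using Arg2pi_ge_0[of w] Arg2pi_lt_2pi[of w] by simp_all
  show "w = cis (2 * pi * (Arg2pi w / (2 * pi)))"
    using Arg2pi_eq[of w] assms by (simp add: cis_conv_exp)
qed

locale tube =
  fixes K :: "(real^3) set" and \<tau> :: "complex \<Rightarrow> real \<Rightarrow> real^3"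
  assumes tube: "tubular_neighbourhood K \<tau>"
begin

lemma continuous_tube: "continuous_on (cball 0 1 \<times> UNIV) (\<lambda>(z, t). \<tau> z t)"
proof -
  obtain U D where "cball 0 1 \<times> UNIV \<subseteq> U"
    and D: "\<And>y. y \<in> U \<Longrightarrow> ((\<lambda>(z, t). \<tau> z t) has_derivative blinfun_apply (D y)) (at y)"
    using tube unfolding tubular_neighbourhood_def by metis
  then show ?thesis
    by (intro has_derivative_continuous_on[OF has_derivative_at_withinI[OF D]]) blast
qed

lemma period_int:
  assumes "z \<in> cball 0 1"
  shows "\<tau> z (t + of_int n) = \<tau> z t"
proof -
  have p: "\<tau> z (t + 1) = \<tau> z t" for t
    using tube assms unfolding tubular_neighbourhood_def by blast
  have nat: "\<tau> z (t + real m) = \<tau> z t" for t m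
  proof (induction m)
    case (Suc m)
    then show ?case using p[of "t + real m"] by (simp add: add_ac)
  qed simp
  show ?thesis
  proof (cases n rule: int_cases2)
    case (nonneg m)
    then show ?thesis using nat by simp
  next
    case (nonpos m)
    then show ?thesis using nat[of "t - real m" m] by simp
  qed
qed

lemma tube_eq_iff:
  assumes "z \<in> cball 0 1" "z' \<in> cball 0 1"
  shows "\<tau> z t = \<tau> z' t' \<longleftrightarrow> z = z' \<and> (\<exists>n::int. t = t' + of_int n)"
proof
  assume eq: "\<tau> z t = \<tau> z' t'"
  have frac: "\<tau> y (frac r) = \<tau> y r" if "y \<in> cball 0 1" for y r
    using period_int[OF that, of "frac r" "\<lfloor>r\<rfloor>"] by (simp add: frac_def)
  have "inj_on (\<lambda>(z, t). \<tau> z t) (cball 0 1 \<times> {0..<1})"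
    using tube by (simp add: tubular_neighbourhood_def)
  moreover have "(\<lambda>(z, t). \<tau> z t) (z, frac t) = (\<lambda>(z, t). \<tau> z t) (z', frac t')"
    using assms eq frac by simp
  moreover have "(z, frac t) \<in> cball 0 1 \<times> {0..<1}" "(z', frac t') \<in> cball 0 1 \<times> {0..<1}"
    using assms by (auto simp: frac_lt_1)
  ultimately have "(z, frac t) = (z', frac t')" by (rule inj_onD)
  then have "z = z'" "t = t' + of_int (\<lfloor>t\<rfloor> - \<lfloor>t'\<rfloor>)" by (simp_all add: frac_def)
  then show "z = z' \<and> (\<exists>n::int. t = t' + of_int n)" by blast
qed (use assms period_int in auto)

text \<open>The tube as an embedding of the solid torus: the angle of the second coordinate replaces the
parameter of \<open>\<tau>\<close> in \<open>\<real>/\<int>\<close>.\<close>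

definition emb :: "complex \<times> complex \<Rightarrow> (real^3) \<times> real" where
  "emb v = stereo (\<tau> (fst v) (Arg2pi (snd v) / (2 * pi)))"

lemma emb_cis:
  assumes "z \<in> cball 0 1"
  shows "emb (z, cis (2 * pi * t)) = stereo (\<tau> z t)"
proof -
  let ?a = "Arg2pi (cis (2 * pi * t))"
  have "cis ?a = cis (2 * pi * t)" using Arg2pi_eq[of "cis (2 * pi * t)"] by (simp add: cis_conv_exp)
  then obtain n :: int where "?a = 2 * pi * t + 2 * pi * of_int n" unfolding cis_eq_iff by blast
  then have "?a / (2 * pi) = t + of_int n" by (simp add: field_simps)
  then show ?thesis using period_int[OF assms] by (simp add: emb_def)
qed

lemma emb_image:
  assumes "A \<subseteq> cball 0 1"
  shows "emb ` (A \<times> sphere 0 1) = stereo ` (\<lambda>(z, t). \<tau> z t) ` (A \<times> UNIV)"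
proof (intro equalityI subsetI)
  fix y assume "y \<in> emb ` (A \<times> sphere 0 1)"
  then obtain z w where zw: "z \<in> A" "norm w = 1" "y = emb (z, w)" by auto
  then obtain t where "w = cis (2 * pi * t)" using cis_surj by metis
  then have "y = stereo (\<tau> z t)" using zw assms emb_cis by auto
  then show "y \<in> stereo ` (\<lambda>(z, t). \<tau> z t) ` (A \<times> UNIV)"
    using zw(1) by (intro image_eqI[of _ stereo] image_eqI[of _ _ "(z, t)"]) auto
next
  fix y assume "y \<in> stereo ` (\<lambda>(z, t). \<tau> z t) ` (A \<times> UNIV)"
  then obtain z t where "z \<in> A" "y = stereo (\<tau> z t)" by auto
  then have "y = emb (z, cis (2 * pi * t))" using assms emb_cis by auto
  then show "y \<in> emb ` (A \<times> sphere 0 1)"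
    using \<open>z \<in> A\<close> by (intro image_eqI[of _ _ "(z, cis (2 * pi * t))"]) auto
qed

lemma inj_emb: "inj_on emb solid_torus"
proof (rule inj_onI)
  fix v v' assume v: "v \<in> solid_torus" "v' \<in> solid_torus" "emb v = emb v'"
  obtain z w z' w' where zw: "v = (z, w)" "v' = (z', w')" by (cases v, cases v')
  obtain t where t: "w = cis (2 * pi * t)" using cis_surj[of w] v(1) zw by (metis mem_Times_iff mem_sphere_0 snd_conv)
  obtain t' where t': "w' = cis (2 * pi * t')" using cis_surj[of w'] v(2) zw by (metis mem_Times_iff mem_sphere_0 snd_conv)
  have "stereo (\<tau> z t) = stereo (\<tau> z' t')"
    using v zw t t' emb_cis[of z t] emb_cis[of z' t'] by simp
  then have "\<tau> z t = \<tau> z' t'" using inj_stereo by (simp add: inj_eq)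
  then obtain n :: int where "z = z'" "t = t' + of_int n" using v zw by (auto simp: tube_eq_iff)
  then show "v = v'" unfolding zw t t' by (auto simp: cis_eq_iff algebra_simps)
qed

lemma continuous_emb: "continuous_on solid_torus emb"
proof -
  let ?q = "\<lambda>(z::complex, t). (z, cis (2 * pi * t))"
  let ?S = "cball (0::complex) 1 \<times> {0..1::real}"
  have S: "compact ?S" by (intro compact_Times) auto
  have q: "continuous_on ?S ?q"
    unfolding split_beta by (intro continuous_intros)
  have "continuous_on ?S (\<lambda>v. stereo (case v of (z, t) \<Rightarrow> \<tau> z t))"
    by (rule continuous_on_compose2[OF continuous_stereo continuous_on_subset[OF continuous_tube]]) auto
  then have "continuous_on ?S (\<lambda>v. emb (?q v))"
    by (rule continuous_on_eq) (auto simp: emb_cis)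
  then have "continuous_on (?q ` ?S) emb" using S q by (intro continuous_on_factor_compact)
  moreover have "?q ` ?S = solid_torus"
  proof (intro equalityI subsetI)
    fix v :: "complex \<times> complex" assume v: "v \<in> solid_torus"
    then have "norm (snd v) = 1" by auto
    then obtain t where "0 \<le> t" "t < 1" "snd v = cis (2 * pi * t)" by (rule cis_surj)
    then have "v = ?q (fst v, t)" "(fst v, t) \<in> ?S" using v by (auto simp: prod_eq_iff)
    then show "v \<in> ?q ` ?S" by (rule image_eqI)
  qed auto
  ultimately show ?thesis by simp
qed

text \<open>The map \<open>\<tau>\<close> is injective on slabs of length one, to which invariance of domain applies.\<close>

lemma open_tube: "openin (top_of_set S3) (emb ` (ball 0 1 \<times> sphere 0 1))"
proof -
  have "open ((\<lambda>(z, t). \<tau> z t) ` (ball 0 1 \<times> {a<..<a + 1}))" for a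
  proof (rule invariance_of_domain_gen)
    show "open (ball (0::complex) 1 \<times> {a<..<a + 1})" by (intro open_Times) auto
    show "continuous_on (ball 0 1 \<times> {a<..<a + 1}) (\<lambda>(z, t). \<tau> z t)"
      by (rule continuous_on_subset[OF continuous_tube]) auto
    show "inj_on (\<lambda>(z, t). \<tau> z t) (ball 0 1 \<times> {a<..<a + 1})"
    proof (rule inj_onI, clarify)
      fix z t z' t'
      assume zt: "z \<in> ball 0 1" "z' \<in> ball 0 1" "t \<in> {a<..<a + 1}" "t' \<in> {a<..<a + 1}" "\<tau> z t = \<tau> z' t'"
      then obtain n :: int where n: "z = z'" "t = t' + of_int n" by (auto simp: tube_eq_iff)
      then have "\<bar>real_of_int n\<bar> < 1" using zt by auto
      then have "n = 0" by linarith
      then show "z = z' \<and> t = t'" using n by simp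
    qed
    show "DIM(real^3) \<le> DIM(complex \<times> real)" by simp
  qed
  then have "open (\<Union>a. (\<lambda>(z, t). \<tau> z t) ` (ball 0 1 \<times> {a<..<a + 1}))" by blast
  also have "(\<Union>a. (\<lambda>(z, t). \<tau> z t) ` (ball 0 1 \<times> {a<..<a + 1})) = (\<lambda>(z, t). \<tau> z t) ` (ball 0 1 \<times> UNIV)"
  proof -
    have "t \<in> {t - 1/2<..<t - 1/2 + 1}" for t :: real by simp
    then show ?thesis unfolding image_UN[symmetric] by blast
  qed
  finally show ?thesis
    by (subst emb_image) (auto intro: open_stereo_image)
qed

definition exterior :: "((real^3) \<times> real) set" where
  "exterior = S3 - emb ` (ball 0 1 \<times> sphere 0 1)"

lemma emb_subset: "emb ` solid_torus \<subseteq> S3"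
  using stereo_in_S3 by (auto simp: emb_def)

lemma exterior_solid_torus: "solid_torus_attached S3 exterior emb"
proof unfold_locales
  have "closedin (top_of_set S3) exterior"
    unfolding exterior_def using open_tube by (simp add: closedin_diff)
  then show "compact exterior" using closedin_compact compact_sphere by blast
  show "S3 = exterior \<union> emb ` solid_torus"
    using emb_subset ball_subset_cball[of "0::complex" 1] unfolding exterior_def by blast
  show "exterior \<inter> emb ` solid_torus = emb ` (sphere 0 1 \<times> sphere 0 1)"
  proof -
    have "emb ` solid_torus - emb ` (ball 0 1 \<times> sphere 0 1) = emb ` (solid_torus - ball 0 1 \<times> sphere 0 1)"
      by (rule inj_on_image_set_diff[OF inj_emb, symmetric]) auto
    also have "solid_torus - ball 0 1 \<times> sphere 0 1 = sphere (0::complex) 1 \<times> sphere 0 1"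
      by auto
    finally show ?thesis using emb_subset unfolding exterior_def by blast
  qed
qed (use inj_emb continuous_emb in auto)

sublocale S3: solid_torus_attached S3 exterior emb
  by (rule exterior_solid_torus)

lemma core_eq: "S3.core = stereo ` K"
proof -
  have "S3.core = stereo ` (\<lambda>(z, t). \<tau> z t) ` ({0} \<times> UNIV)"
    unfolding S3.core_def by (rule emb_image) simp
  also have "(\<lambda>(z, t). \<tau> z t) ` ({0} \<times> UNIV) = range (\<tau> 0)" by force
  also have "\<dots> = K" using tube by (simp add: tubular_neighbourhood_def)
  finally show ?thesis .
qed

lemma knot_complement_eq: "knot_complement K = S3 - S3.core"
  by (simp add: knot_complement_def core_eq)

text \<open>The complement of the knot is connected and locally path connected, and the exterior is its image
under the radial retraction.\<close>

lemma path_connected_exterior: "path_connected exterior"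
proof -
  have "connected (S3 - S3.core)"
    by (rule S3.connected_minus_core) (rule connected_sphere, simp)
  moreover have "locally path_connected (S3 - S3.core)"
  proof (rule locally_open_subset[OF locally_path_connected_sphere])
    show "openin (top_of_set S3) (S3 - S3.core)"
      using S3.closed_P_core(2) unfolding Diff_eq by (intro openin_open_Int open_Compl)
  qed
  ultimately have "path_connected (S3 - S3.core)"
    using path_component_eq_connected_component[of "S3 - S3.core"]
    by (metis path_connected_component connected_iff_connected_component)
  then have "path_connected (S3.radial 1 ` (S3 - S3.core))"
    by (rule path_connected_continuous_image[OF S3.continuous_radial_1])
  moreover have "S3.radial 1 ` (S3 - S3.core) = exterior"
  proof (intro equalityI subsetI)
    fix x assume "x \<in> exterior"
    moreover from this have "x \<in> S3 - S3.core" using S3.P_disjoint_core unfolding exterior_def by blast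
    ultimately have "x = S3.radial 1 x" "x \<in> S3 - S3.core" by simp_all
    then show "x \<in> S3.radial 1 ` (S3 - S3.core)" by (rule image_eqI)
  qed (use S3.radial_1_in_P in auto)
  ultimately show ?thesis by simp
qed

end

section \<open>Curves on the boundary torus\<close>

context tube
begin

text \<open>The covering of the boundary torus by the plane. Torus curves lift to straight segments from the
origin to lattice points.\<close>

definition torus_map :: "real \<times> real \<Rightarrow> (real^3) \<times> real" where
  "torus_map v = stereo (\<tau> (cis (2 * pi * fst v)) (snd v))"

lemma torus_curve_eq: "torus_curve \<tau> m n = torus_map \<circ> linepath (0, 0) (of_int m, of_int n)"
  by (auto simp: torus_curve_def torus_map_def linepath_def fun_eq_iff mult_ac)

lemma torus_map_period: "torus_map (a + of_int m, b + of_int n) = torus_map (a, b)"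
proof -
  have "cis (2 * pi * (a + of_int m)) = cis (2 * pi * a)"
    unfolding cis_eq_iff by (auto simp: algebra_simps)
  then show ?thesis
    using period_int[of "cis (2 * pi * a)" b n] by (simp add: torus_map_def)
qed

lemma continuous_torus_map: "continuous_on UNIV torus_map"
proof -
  have "continuous_on UNIV (\<lambda>v. (\<lambda>(z, t). \<tau> z t) (cis (2 * pi * fst v), snd v))"
    by (rule continuous_on_compose2[OF continuous_tube]) (auto intro!: continuous_intros)
  then have "continuous_on UNIV (\<lambda>v. stereo ((\<lambda>(z, t). \<tau> z t) (cis (2 * pi * fst v), snd v)))"
    by (rule continuous_on_compose2[OF continuous_stereo]) auto
  then show ?thesis by (simp add: torus_map_def[abs_def])
qed

lemma exterior_subset: "exterior \<subseteq> knot_complement K"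
  using S3.P_disjoint_core by (auto simp: knot_complement_eq exterior_def)

lemma torus_map_in_exterior: "torus_map v \<in> exterior"
proof -
  have "torus_map v = emb (cis (2 * pi * fst v), cis (2 * pi * snd v))"
    by (subst emb_cis) (simp_all add: torus_map_def)
  also have "\<dots> \<in> emb ` (sphere 0 1 \<times> sphere 0 1)" by (rule imageI) simp
  finally show ?thesis using S3.boundary by blast
qed

lemma torus_curve_in_exterior: "torus_curve \<tau> m n t \<in> exterior"
  by (simp add: torus_curve_eq torus_map_in_exterior)

lemma torus_point_in_exterior: "torus_point \<tau> \<in> exterior"
  using torus_curve_in_exterior[of 0 0 0] by (simp add: torus_curve_def torus_point_def)

lemma torus_curve_loop: "torus_curve \<tau> m n \<in> loops (knot_complement K) (torus_point \<tau>)"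
proof -
  have "path (torus_curve \<tau> m n)"
    unfolding torus_curve_eq
    by (intro path_continuous_image path_linepath continuous_on_subset[OF continuous_torus_map]) simp
  moreover have "path_image (torus_curve \<tau> m n) \<subseteq> knot_complement K"
    using torus_map_in_exterior exterior_subset unfolding torus_curve_eq path_image_def by fastforce
  moreover have "pathstart (torus_curve \<tau> m n) = torus_point \<tau>"
    by (simp add: pathstart_def torus_curve_def torus_point_def)
  moreover have "pathfinish (torus_curve \<tau> m n) = torus_map (0 + of_int m, 0 + of_int n)"
    by (simp add: pathfinish_def torus_curve_eq linepath_def)
  then have "pathfinish (torus_curve \<tau> m n) = torus_point \<tau>"
    unfolding torus_map_period by (simp add: torus_map_def torus_point_def)
  ultimately show ?thesis by (simp add: loops_def)
qed

text \<open>In the plane both sides are paths from the origin to the same lattice point.\<close>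

lemma torus_curve_join:
  "homotopic_paths (knot_complement K) (torus_curve \<tau> m n +++ torus_curve \<tau> m' n') (torus_curve \<tau> (m + m') (n + n'))"
proof -
  let ?O = "(0, 0) :: real \<times> real" and ?v = "(of_int m, of_int n) :: real \<times> real"
    and ?w = "(of_int (m + m'), of_int (n + n')) :: real \<times> real"
  have "torus_curve \<tau> m' n' = torus_map \<circ> linepath ?v ?w"
  proof
    fix t
    have "linepath ?v ?w t = (t * of_int m' + of_int m, t * of_int n' + of_int n)"
      by (simp add: linepath_def algebra_simps)
    then have "(torus_map \<circ> linepath ?v ?w) t = torus_map (t * of_int m', t * of_int n')"
      by (simp add: torus_map_period)
    then show "torus_curve \<tau> m' n' t = (torus_map \<circ> linepath ?v ?w) t"
      by (simp add: torus_curve_eq linepath_def)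
  qed
  then have "torus_curve \<tau> m n +++ torus_curve \<tau> m' n' = torus_map \<circ> (linepath ?O ?v +++ linepath ?v ?w)"
    by (simp add: path_compose_join torus_curve_eq[of m n])
  moreover have "homotopic_paths (knot_complement K) (torus_map \<circ> (linepath ?O ?v +++ linepath ?v ?w)) (torus_map \<circ> linepath ?O ?w)"
  proof (rule homotopic_paths_continuous_image)
    show "homotopic_paths UNIV (linepath ?O ?v +++ linepath ?v ?w) (linepath ?O ?w)"
      by (rule homotopic_paths_linear) auto
  qed (use continuous_torus_map torus_map_in_exterior exterior_subset in auto)
  ultimately show ?thesis by (simp add: torus_curve_eq[of "m + m'"])
qed

end

lemma (in group) additive_int_pow:
  assumes "\<And>i. e i \<in> carrier G" "\<And>i j. e (i + j) = e i \<otimes> e j"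
  shows "e (i::int) = e 1 [^] i"
proof -
  have e0: "e 0 = \<one>" using assms(2)[of 0 0] assms(1)[of 0] by (simp add: l_cancel_one)
  have nat: "e (int n) = e 1 [^] n" for n
  proof (induction n)
    case (Suc n)
    then show ?case using assms(2)[of "int n" 1] by (simp add: add.commute)
  qed (simp add: e0)
  show ?thesis
  proof (cases i rule: int_cases2)
    case (nonneg n)
    then show ?thesis by (simp add: nat int_pow_int)
  next
    case (nonpos n)
    have "e (- int n) \<otimes> e (int n) = \<one>" using assms(2)[of "- int n" "int n"] e0 by simp
    then have "inv (e (int n)) = e (- int n)" by (rule inv_equality) (use assms in auto)
    then show ?thesis using nonpos assms(1) by (simp add: nat int_pow_neg_int)
  qed
qed

section \<open>The fundamental group of the surgered manifold\<close>

locale knot_surgery = tube K \<tau> for K \<tau> +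
  fixes p q :: int and Y :: "'b::t2_space set" and f :: "(real^3) \<times> real \<Rightarrow> 'b" and g :: "complex \<times> complex \<Rightarrow> 'b"
  assumes f: "continuous_on exterior f" "inj_on f exterior"
    and g: "continuous_on solid_torus g" "inj_on g solid_torus"
    and Y: "Y = f ` exterior \<union> g ` solid_torus"
    and fg: "f ` exterior \<inter> g ` solid_torus = g ` (sphere 0 1 \<times> sphere 0 1)"
    and slope: "g ` (sphere 0 1 \<times> {1}) = f ` torus_curve \<tau> p q ` {0..1}"
begin

sublocale Y: solid_torus_attached Y "f ` exterior" g
proof unfold_locales
  show "compact (f ` exterior)" by (rule compact_continuous_image[OF f(1) S3.P])
qed (fact g Y fg)+

text \<open>Loops in the knot complement are viewed in the surgered manifold by retracting them into the exterior.\<close>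

definition collapse :: "(real^3) \<times> real \<Rightarrow> 'b" where
  "collapse x = f (S3.radial 1 x)"

lemma collapse_exterior: "x \<in> exterior \<Longrightarrow> collapse x = f x"
  by (simp add: collapse_def)

lemma continuous_collapse: "continuous_on (knot_complement K) collapse"
  unfolding collapse_def[abs_def] knot_complement_eq
  by (rule continuous_on_compose2[OF f(1) S3.continuous_radial_1]) (use S3.radial_1_in_P in blast)

lemma collapse_in_Y: "x \<in> knot_complement K \<Longrightarrow> collapse x \<in> Y"
  using S3.radial_1_in_P unfolding collapse_def knot_complement_eq Y by blast

lemma path_connected_Y: "path_connected Y"
  by (rule Y.path_connected_Z[OF path_connected_continuous_image[OF f(1) path_connected_exterior]])

text \<open>A loop pushed into the image of the exterior is the image of a loop there, as \<open>f\<close> is an embedding.\<close>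

lemma loop_lifts:
  assumes \<gamma>: "\<gamma> \<in> loops Y (f x)" and x: "x \<in> exterior"
  obtains \<beta> where "\<beta> \<in> loops (knot_complement K) x" "homotopic_paths Y \<gamma> (collapse \<circ> \<beta>)"
proof -
  have \<gamma>s: "path \<gamma>" "path_image \<gamma> \<subseteq> Y" "pathstart \<gamma> = f x" "pathfinish \<gamma> = f x"
    using \<gamma> by (auto simp: loops_def)
  then obtain \<gamma>' where \<gamma>': "path \<gamma>'" "path_image \<gamma>' \<subseteq> f ` exterior" "homotopic_paths Y \<gamma> \<gamma>'"
    using Y.push_into_P[of \<gamma>] x by auto
  have ends: "\<gamma>' 0 = f x" "\<gamma>' 1 = f x"
    using homotopic_paths_imp_pathstart[OF \<gamma>'(3)] homotopic_paths_imp_pathfinish[OF \<gamma>'(3)] \<gamma>s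
    by (simp_all add: pathstart_def pathfinish_def)
  let ?i = "the_inv_into exterior f"
  have \<gamma>'t: "\<gamma>' t \<in> f ` exterior" if "t \<in> {0..1}" for t
    using \<gamma>'(2) that unfolding path_image_def by blast
  have i: "?i (\<gamma>' t) \<in> exterior" "f (?i (\<gamma>' t)) = \<gamma>' t" if "t \<in> {0..1}" for t
    using the_inv_into_into[OF f(2) \<gamma>'t[OF that] subset_refl] f_the_inv_into_f[OF f(2) \<gamma>'t[OF that]] by auto
  have ix: "?i (f x) = x" using f(2) x by (rule the_inv_into_f_f)
  show ?thesis
  proof (rule that)
    have "path (?i \<circ> \<gamma>')"
      using \<gamma>'(1,2) continuous_on_subset[OF continuous_on_inv_into[OF f(1) S3.P f(2)]]
      by (intro path_continuous_image) auto
    then show "?i \<circ> \<gamma>' \<in> loops (knot_complement K) x"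
      using i(1) exterior_subset ends ix
      unfolding loops_def path_image_def pathstart_def pathfinish_def by auto
    have "homotopic_paths Y \<gamma>' (collapse \<circ> (?i \<circ> \<gamma>'))"
    proof (rule homotopic_paths_eq)
      show "path \<gamma>'" by fact
      show "path_image \<gamma>' \<subseteq> Y" using \<gamma>'(2) unfolding Y by blast
      fix t :: real assume "t \<in> {0..1}"
      then show "\<gamma>' t = (collapse \<circ> (?i \<circ> \<gamma>')) t" using i collapse_exterior by simp
    qed
    with \<gamma>'(3) show "homotopic_paths Y \<gamma> (collapse \<circ> (?i \<circ> \<gamma>'))" by (rule homotopic_paths_trans)
  qed
qed

text \<open>The curve lies in the image of the meridian disc \<open>cball 0 1 \<times> {1}\<close>, where it contracts linearly.\<close>

lemma slope_null_homotopic: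
  "homotopic_paths Y (collapse \<circ> torus_curve \<tau> p q) (\<lambda>_. collapse (torus_point \<tau>))"
proof -
  let ?\<gamma> = "collapse \<circ> torus_curve \<tau> p q"
  have loop: "path (torus_curve \<tau> p q)" "path_image (torus_curve \<tau> p q) \<subseteq> knot_complement K"
    using torus_curve_loop[of p q] by (auto simp: loops_def)
  have path: "path ?\<gamma>"
    by (rule path_continuous_image[OF loop(1) continuous_on_subset[OF continuous_collapse loop(2)]])
  have \<gamma>t: "?\<gamma> t \<in> g ` (sphere 0 1 \<times> {1})" if "t \<in> {0..1}" for t
    using that collapse_exterior[OF torus_curve_in_exterior] unfolding slope by simp
  let ?i = "the_inv_into solid_torus g"
  have i: "?i (?\<gamma> t) \<in> cball 0 1 \<times> {1}" "g (?i (?\<gamma> t)) = ?\<gamma> t" if t: "t \<in> {0..1}" for t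
  proof -
    obtain z where z: "norm z = 1" "?\<gamma> t = g (z, 1)" using \<gamma>t[OF t] by auto
    then have "?i (?\<gamma> t) = (z, 1)" using the_inv_into_f_f[OF g(2), of "(z, 1)"] by simp
    then show "?i (?\<gamma> t) \<in> cball 0 1 \<times> {1}" "g (?i (?\<gamma> t)) = ?\<gamma> t" using z by simp_all
  qed
  have sub: "path_image ?\<gamma> \<subseteq> g ` solid_torus"
    using \<gamma>t unfolding path_image_def by fastforce
  have "path (?i \<circ> ?\<gamma>)"
    using continuous_on_subset[OF continuous_on_inv_into[OF g(1) Y.compact_solid_torus g(2)] sub]
    by (intro path_continuous_image path)
  then have "homotopic_paths (cball 0 1 \<times> {1}) (?i \<circ> ?\<gamma>) (\<lambda>_. ?i (?\<gamma> 0))"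
  proof (rule homotopic_paths_linear)
    have "?\<gamma> 1 = ?\<gamma> 0"
      using torus_curve_loop[of p q] by (simp add: loops_def pathstart_def pathfinish_def)
    then show "pathstart (\<lambda>_. ?i (?\<gamma> 0)) = pathstart (?i \<circ> ?\<gamma>)" "pathfinish (\<lambda>_. ?i (?\<gamma> 0)) = pathfinish (?i \<circ> ?\<gamma>)"
      by (simp_all add: pathstart_def pathfinish_def)
    fix t :: real assume t: "t \<in> {0..1}"
    have "convex (cball (0::complex) 1 \<times> {1::complex})" by (intro convex_Times) auto
    then show "closed_segment ((?i \<circ> ?\<gamma>) t) (?i (?\<gamma> 0)) \<subseteq> cball 0 1 \<times> {1}"
      using i(1)[OF t] i(1)[of 0] by (intro closed_segment_subset) (simp_all del: mem_Times_iff)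
  qed simp
  then have disc: "homotopic_paths Y (g \<circ> (?i \<circ> ?\<gamma>)) (g \<circ> (\<lambda>_. ?i (?\<gamma> 0)))"
  proof (rule homotopic_paths_continuous_image)
    show "continuous_on (cball 0 1 \<times> {1}) g" by (rule continuous_on_subset[OF g(1)]) auto
    show "g \<in> cball 0 1 \<times> {1} \<rightarrow> Y" unfolding Y by fastforce
  qed
  have "homotopic_paths Y ?\<gamma> (g \<circ> (?i \<circ> ?\<gamma>))"
  proof (rule homotopic_paths_eq[OF path])
    show "path_image ?\<gamma> \<subseteq> Y" using sub unfolding Y by blast
  qed (use i(2) in simp)
  then have hom: "homotopic_paths Y ?\<gamma> (g \<circ> (\<lambda>_. ?i (?\<gamma> 0)))"
    using disc by (rule homotopic_paths_trans)
  have "torus_curve \<tau> p q 0 = torus_point \<tau>"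
    by (simp add: torus_curve_def torus_point_def)
  then have const: "g \<circ> (\<lambda>_. ?i (?\<gamma> 0)) = (\<lambda>_. collapse (torus_point \<tau>))"
    using i(2)[of 0] unfolding comp_def by auto
  show ?thesis by (rule subst[OF const, of "homotopic_paths Y ?\<gamma>"]) (rule hom)
qed

context
  fixes y :: 'b and d :: "real \<Rightarrow> 'b"
  assumes d: "path d" "path_image d \<subseteq> Y" "pathstart d = collapse (torus_point \<tau>)" "pathfinish d = y"
begin

text \<open>The base point of the surgered manifold is arbitrary; loops are carried to it along the path \<open>d\<close>.\<close>

definition transport :: "(real \<Rightarrow> (real^3) \<times> real) \<Rightarrow> real \<Rightarrow> 'b" where
  "transport \<beta> = conjugate_loop d (collapse \<circ> \<beta>)"

lemma collapse_loops:
  "\<beta> \<in> loops (knot_complement K) (torus_point \<tau>) \<Longrightarrow> collapse \<circ> \<beta> \<in> loops Y (collapse (torus_point \<tau>))"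
  using collapse_in_Y continuous_on_subset[OF continuous_collapse]
  by (auto simp: loops_def path_image_compose pathstart_compose pathfinish_compose intro!: path_continuous_image)

lemma transport_loops:
  "\<beta> \<in> loops (knot_complement K) (torus_point \<tau>) \<Longrightarrow> transport \<beta> \<in> loops Y y"
  unfolding transport_def by (rule conjugate_loop_loops[OF d collapse_loops])

lemma transport_homotopic:
  assumes "\<beta> \<in> loops (knot_complement K) (torus_point \<tau>)" "homotopic_paths (knot_complement K) \<beta> \<beta>'"
  shows "homotopic_paths Y (transport \<beta>) (transport \<beta>')"
  unfolding transport_def
  by (rule conjugate_loop_homotopic[OF d homotopic_paths_continuous_image[OF assms(2) continuous_collapse] collapse_loops[OF assms(1)]])
    (use collapse_in_Y in blast)

abbreviation "transport_class \<equiv> induced Y transport"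

lemma transport_class: "\<beta> \<in> loops (knot_complement K) (torus_point \<tau>) \<Longrightarrow>
    transport_class (loop_class (knot_complement K) \<beta>) = loop_class Y (transport \<beta>)"
  by (rule induced_class) (use transport_homotopic in auto)

lemma transport_class_hom:
  "transport_class \<in> hom (fundamental_group (knot_complement K) (torus_point \<tau>)) (fundamental_group Y y)"
proof (rule induced_hom)
  fix \<alpha> \<beta> assume "\<alpha> \<in> loops (knot_complement K) (torus_point \<tau>)" "\<beta> \<in> loops (knot_complement K) (torus_point \<tau>)"
  then show "homotopic_paths Y (transport (\<alpha> +++ \<beta>)) (transport \<alpha> +++ transport \<beta>)"
    unfolding transport_def path_compose_join by (intro conjugate_loop_join[OF d] collapse_loops)
qed (use transport_loops transport_homotopic in auto)

text \<open>A loop at \<open>y\<close> is moved back along \<open>d\<close> and lifted to the knot complement.\<close>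

lemma transport_class_surj:
  assumes "A \<in> carrier (fundamental_group Y y)"
  obtains B where "B \<in> carrier (fundamental_group (knot_complement K) (torus_point \<tau>))" "transport_class B = A"
proof -
  obtain \<gamma> where A: "A = loop_class Y \<gamma>" and \<gamma>: "\<gamma> \<in> loops Y y"
    using assms unfolding carrier_fundamental_group by blast
  let ?\<gamma> = "conjugate_loop (reversepath d) \<gamma>"
  have "?\<gamma> \<in> loops Y (f (torus_point \<tau>))"
    using conjugate_loop_loops[of "reversepath d" Y y _ \<gamma>] d \<gamma> collapse_exterior[OF torus_point_in_exterior] by simp
  then obtain \<beta> where \<beta>: "\<beta> \<in> loops (knot_complement K) (torus_point \<tau>)" "homotopic_paths Y ?\<gamma> (collapse \<circ> \<beta>)"
    using loop_lifts torus_point_in_exterior by blast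
  have "homotopic_paths Y (transport \<beta>) (conjugate_loop d ?\<gamma>)"
    unfolding transport_def
    by (rule conjugate_loop_homotopic[OF d homotopic_paths_sym[OF \<beta>(2)] collapse_loops[OF \<beta>(1)]])
  also have "homotopic_paths Y (conjugate_loop d ?\<gamma>) \<gamma>"
    by (rule conjugate_loop_surj[OF d \<gamma>])
  finally have "transport_class (loop_class (knot_complement K) \<beta>) = A"
    unfolding transport_class[OF \<beta>(1)] A by (rule loop_class_eq)
  then show ?thesis using that \<beta>(1) unfolding carrier_fundamental_group by blast
qed

lemma transport_class_slope:
  "transport_class (loop_class (knot_complement K) (torus_curve \<tau> p q)) = \<one>\<^bsub>fundamental_group Y y\<^esub>"
proof -
  have "homotopic_paths Y (transport (torus_curve \<tau> p q)) (conjugate_loop d (\<lambda>_. collapse (torus_point \<tau>)))"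
    unfolding transport_def
    by (rule conjugate_loop_homotopic[OF d slope_null_homotopic collapse_loops[OF torus_curve_loop]])
  also have "homotopic_paths Y \<dots> (reversepath d +++ d)"
    unfolding conjugate_loop_def using d
    by (intro homotopic_paths_join homotopic_paths_const_left) auto
  also have "homotopic_paths Y \<dots> (\<lambda>_. y)"
    using homotopic_paths_join_reversepath[of "reversepath d" Y] d by simp
  finally show ?thesis
    unfolding transport_class[OF torus_curve_loop] fundamental_group_def by (simp add: loop_class_eq)
qed

definition torus_class :: "int \<Rightarrow> int \<Rightarrow> (real \<Rightarrow> 'b) set" where
  "torus_class m n = transport_class (loop_class (knot_complement K) (torus_curve \<tau> m n))"

lemma torus_class_closed: "torus_class m n \<in> carrier (fundamental_group Y y)"
  unfolding torus_class_def transport_class[OF torus_curve_loop] carrier_fundamental_group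
  using transport_loops[OF torus_curve_loop] by blast

lemma torus_class_add:
  "torus_class (m + m') (n + n') = torus_class m n \<otimes>\<^bsub>fundamental_group Y y\<^esub> torus_class m' n'"
proof -
  let ?C = "knot_complement K"
  have "torus_class m n \<otimes>\<^bsub>fundamental_group Y y\<^esub> torus_class m' n' =
      transport_class (loop_class ?C (torus_curve \<tau> m n) \<otimes>\<^bsub>fundamental_group ?C (torus_point \<tau>)\<^esub> loop_class ?C (torus_curve \<tau> m' n'))"
    unfolding torus_class_def
    by (rule hom_mult[OF transport_class_hom, symmetric]) (use torus_curve_loop in \<open>auto simp: carrier_fundamental_group\<close>)
  also have "\<dots> = torus_class (m + m') (n + n')"
    unfolding torus_class_def fundamental_group_mult[OF torus_curve_loop torus_curve_loop]
    using loop_class_eq[OF torus_curve_join] by simp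
  finally show ?thesis ..
qed

text \<open>Meridian and longitude become \<open>torus_class 1 0\<close> and \<open>torus_class 0 1\<close>. Additivity of \<open>torus_class\<close>
shows that they commute and that \<open>M\<^sup>p L\<^sup>q\<close> is \<open>torus_class p q\<close>, which is trivial. The
meridian is \<open>c\<close>, and \<open>c\<close> and \<open>l\<close> generate because every class is transported from the knot group.\<close>

theorem surgery_not_left_orderable:
  assumes "chirality_convention s K \<tau>" "s \<ge> 1" "q > 0" "coprime p q" "p \<ge> (2 * s + 3) * q" "y \<in> Y"
  shows "\<not> left_orderable (fundamental_group Y y)"
proof -
  let ?C = "knot_complement K" and ?G = "fundamental_group Y y"
  define R where "R = {knot_relator s}"
  obtain \<phi> where \<phi>: "\<phi> \<in> iso (presented_group R) (fundamental_group ?C (torus_point \<tau>))"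
    and mer: "\<phi> (word_class R meridian_word) = loop_class ?C (meridian \<tau>)"
    and lon: "\<phi> (word_class R (longitude_word s)) = loop_class ?C (longitude \<tau>)"
    using assms(1) unfolding chirality_convention_def R_def by blast
  have hom: "transport_class \<circ> \<phi> \<in> hom (presented_group R) ?G"
  proof (rule hom_compose[OF _ transport_class_hom])
    show "\<phi> \<in> hom (presented_group R) (fundamental_group ?C (torus_point \<tau>))"
      using \<phi> unfolding iso_def by blast
  qed
  interpret G: group ?G by (rule group_fundamental_group) fact
  interpret presented_group_hom ?G R "transport_class \<circ> \<phi>"
    by unfold_locales (rule hom)
  let ?c = "gen_val gen_c" and ?l = "gen_val gen_l" and ?L = "val (longitude_word s)"
  have c: "?c = torus_class 1 0"
    using mer by (simp add: gen_val_def val_def torus_class_def meridian_word_def power_word_def)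
  have L: "?L = torus_class 0 1"
    using lon by (simp add: val_def torus_class_def)
  show ?thesis
  proof (rule G.pretzel_surgery_quotient_not_left_orderable[of ?c ?l s q p ?L])
    fix H assume H: "subgroup H ?G" "?c \<in> H" "?l \<in> H"
    have "gen_val x \<in> H" for x using H(2,3) by (cases x) simp_all
    then have "val w \<in> H" for w by (rule val_in_subgroup[OF H(1)])
    moreover have "\<exists>w. A = val w" if A: "A \<in> carrier ?G" for A
    proof -
      obtain B where B: "B \<in> carrier (fundamental_group ?C (torus_point \<tau>))" "transport_class B = A"
        using transport_class_surj[OF A] .
      have "carrier (fundamental_group ?C (torus_point \<tau>)) = \<phi> ` range (word_class R)"
        using \<phi> unfolding iso_def bij_betw_def carrier_presented by blast
      then obtain w where "B = \<phi> (word_class R w)" using B(1) by blast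
      then show ?thesis using B(2) by (intro exI[of _ w]) (simp add: val_def)
    qed
    ultimately show "H = carrier ?G" using subgroup.subset[OF H(1)] by blast
  next
    have "val (knot_relator s) = \<one>\<^bsub>?G\<^esub>" by (rule val_relator) (simp add: R_def)
    then show "?c \<otimes>\<^bsub>?G\<^esub> ?l \<otimes>\<^bsub>?G\<^esub> ?c \<otimes>\<^bsub>?G\<^esub> inv\<^bsub>?G\<^esub> ?l \<otimes>\<^bsub>?G\<^esub> inv\<^bsub>?G\<^esub> ?c \<otimes>\<^bsub>?G\<^esub> ?l [^]\<^bsub>?G\<^esub> - s \<otimes>\<^bsub>?G\<^esub> inv\<^bsub>?G\<^esub> ?c \<otimes>\<^bsub>?G\<^esub> inv\<^bsub>?G\<^esub> ?l \<otimes>\<^bsub>?G\<^esub>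
        ?c \<otimes>\<^bsub>?G\<^esub> ?l \<otimes>\<^bsub>?G\<^esub> ?c \<otimes>\<^bsub>?G\<^esub> ?l [^]\<^bsub>?G\<^esub> (s - 1) = \<one>\<^bsub>?G\<^esub>"
      unfolding knot_relator_def val_power_word_Cons val_power_word_Nil
      by (simp add: G.m_assoc G.int_pow_neg[of _ 1])
  next
    show "?L = ?c [^]\<^bsub>?G\<^esub> - (2 * s - 2) \<otimes>\<^bsub>?G\<^esub> ?l \<otimes>\<^bsub>?G\<^esub> ?c \<otimes>\<^bsub>?G\<^esub> ?l [^]\<^bsub>?G\<^esub> s \<otimes>\<^bsub>?G\<^esub> ?c \<otimes>\<^bsub>?G\<^esub> ?l [^]\<^bsub>?G\<^esub> s \<otimes>\<^bsub>?G\<^esub> ?c \<otimes>\<^bsub>?G\<^esub> ?l \<otimes>\<^bsub>?G\<^esub>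
        ?c [^]\<^bsub>?G\<^esub> - (2 * s + 9)"
      unfolding longitude_word_def val_power_word_Cons val_power_word_Nil
      by (simp add: G.m_assoc)
  next
    show "?c \<otimes>\<^bsub>?G\<^esub> ?L = ?L \<otimes>\<^bsub>?G\<^esub> ?c"
      unfolding c L torus_class_add[symmetric] by simp
  next
    have m: "torus_class m 0 = torus_class 1 0 [^]\<^bsub>?G\<^esub> m" for m
      by (rule G.additive_int_pow[of "\<lambda>m. torus_class m 0"])
        (use torus_class_closed torus_class_add[of _ _ 0 0] in auto)
    have l: "torus_class 0 n = torus_class 0 1 [^]\<^bsub>?G\<^esub> n" for n
      by (rule G.additive_int_pow[of "\<lambda>n. torus_class 0 n"])
        (use torus_class_closed torus_class_add[of 0 0] in auto)
    have "?c [^]\<^bsub>?G\<^esub> p \<otimes>\<^bsub>?G\<^esub> ?L [^]\<^bsub>?G\<^esub> q = torus_class p q"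
      unfolding c L m[of p, symmetric] l[of q, symmetric] torus_class_add[symmetric] by simp
    then show "?c [^]\<^bsub>?G\<^esub> p \<otimes>\<^bsub>?G\<^esub> ?L [^]\<^bsub>?G\<^esub> q = \<one>\<^bsub>?G\<^esub>"
      by (simp add: torus_class_def transport_class_slope)
  qed (use assms in auto)
qed

end

end

theorem theorem2:
  fixes s p q :: int
    and K :: "(real^3) set"
    and \<tau> :: "complex \<Rightarrow> real \<Rightarrow> real^3"
    and Y :: "'b::t2_space set"
    and y :: 'b
  assumes "s \<ge> 3"
    and "pretzel_knot_Ks s K \<tau>"
    and "q > 0" and "coprime p q"
    and "rat_of_int p / rat_of_int q \<ge> rat_of_int (2 * s + 3)"
    and "dehn_surgery \<tau> p q Y"
    and "y \<in> Y"
  shows "\<not> left_orderable (fundamental_group Y y)"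
proof -
  interpret tube K \<tau>
    using assms(2) by unfold_locales (simp add: pretzel_knot_Ks_def framed_neighbourhood_def)
  have X: "S3 - stereo ` (\<lambda>(z, t). \<tau> z t) ` (ball 0 1 \<times> UNIV) = exterior"
    unfolding exterior_def by (subst emb_image) auto
  obtain f :: "(real^3) \<times> real \<Rightarrow> 'b" and g :: "complex \<times> complex \<Rightarrow> 'b" where
    "continuous_on exterior f \<and> inj_on f exterior \<and>
       continuous_on (cball 0 1 \<times> sphere 0 1) g \<and> inj_on g (cball 0 1 \<times> sphere 0 1) \<and>
       Y = f ` exterior \<union> g ` (cball 0 1 \<times> sphere 0 1) \<and>
       f ` exterior \<inter> g ` (cball 0 1 \<times> sphere 0 1) = f ` stereo ` (\<lambda>(z, t). \<tau> z t) ` (sphere 0 1 \<times> UNIV) \<and>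
       f ` stereo ` (\<lambda>(z, t). \<tau> z t) ` (sphere 0 1 \<times> UNIV) = g ` (sphere 0 1 \<times> sphere 0 1) \<and>
       g ` (sphere 0 1 \<times> {1}) = f ` torus_curve \<tau> p q ` {0..1}"
    using assms(6) unfolding dehn_surgery_def X Let_def by (elim exE) (rule that)
  then interpret knot_surgery K \<tau> p q Y f g
    by unfold_locales auto
  have "collapse (torus_point \<tau>) \<in> Y"
    using collapse_in_Y exterior_subset torus_point_in_exterior by blast
  then obtain d where d: "path d" "path_image d \<subseteq> Y" "pathstart d = collapse (torus_point \<tau>)" "pathfinish d = y"
    using path_connected_Y assms(7) unfolding path_connected_def by blast
  have "of_int p \<ge> of_int (2 * s + 3) * rat_of_int q"
    using assms(3,5) by (simp add: le_divide_eq)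
  then have "rat_of_int ((2 * s + 3) * q) \<le> rat_of_int p" by (simp only: of_int_mult)
  then have "(2 * s + 3) * q \<le> p" by (simp only: of_int_le_iff)
  then show ?thesis
    using surgery_not_left_orderable[OF d, of s] assms by (simp add: pretzel_knot_Ks_def)
qed

end
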